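(* Let $\mathcal X$ be the space of infinite sequences over the alphabet $\{0_0,0_1,1\}$ all of whose two-letter subwords belong to $\{0_00_1,\,0_10_0,\,0_11,\,10_0,\,10_1,\,11\}$. Let $\widehat G$ be the group of transformations of $\mathcal X$ generated by $a_0,a_1,b,c,d$ defined below. Then the growth of $\widehat G$ satisfies $\gamma_{\widehat G}(R)\preceq\exp(R^\alpha)$ for every $$\alpha>\frac{\log 2}{\log 2-\log\eta}\approx 0.83473,$$ where $\eta\approx 0.87176$ is the positive root of $x^4+x^3+x^2-2$.
   Context: Actions are from the right. Define the transformation $a$ of $\mathcal X$ by $$(0_xw)\cdot a=1w,\qquad (10_xw)\cdot a=0_{1-x}0_xw,\qquad (11w)\cdot a=0_11w,$$ for $x\in\{0,1\}$, and define $b,c,d$ recursively by $$(0_{1-x}0_xw)\cdot b=0_1(0_xw\cdot a),\quad (0_110_xw)\cdot b=0_x(10_xw\cdot a),\quad (0_111w)\cdot b=0_0(11w\cdot a),\quad (1w)\cdot b=1(w\cdot c),$$ $$(0_{1-x}0_xw)\cdot c=0_1(0_xw\cdot a),\quad (0_110_xw)\cdot c=0_x(10_xw\cdot a),\quad (0_111w)\cdot c=0_0(11w\cdot a),\quad (1w)\cdot c=1(w\cdot d),$$ $$(0_xw)\cdot d=0_xw,\qquad (1w)\cdot d=1(w\cdot b).$$ The transformation $a$ is decomposed into a product of two disjoint involutions $a_0,a_1$: the involution $a_0$ exchanges $10_1w\leftrightarrow 0_00_1w$ and fixes all other sequences; the involution $a_1$ exchanges $1xw\leftrightarrow 0_1xw$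 for $x\in\{0_0,1\}$ and fixes all other sequences. For a group $G$ with finite symmetric generating set $S$ (here $S=\{a_0,a_1,b,c,d\}$), $|g|$ is the minimal $\ell\in\mathbb{N}$ such that $g$ is a product of $\ell$ elements of $S$, and $\gamma_G(R)$ is the number of $g\in G$ with $|g|\le R$. The notation $f_1(R)\preceq f_2(R)$ means that there exists $C\ge 1$ with $f_1(R)\le f_2(CR)$ for all $R\ge 1$. *)

theory Defs
  imports "HOL-Algebra.Bij" "HOL-Algebra.Elementary_Groups" "HOL-Library.Stream" Complex_Main
begin

section \<open>Word growth\<close>

text \<open>For elements that are not products of elements of \<open>S\<close> the value is unspecified; this does
  not occur when \<open>S\<close> is symmetric and generates \<open>G\<close>.\<close>

definition word_length :: "('a, 'b) monoid_scheme \<Rightarrow> 'a set \<Rightarrow> 'a \<Rightarrow> nat" where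
  "word_length G S g =
     (LEAST l. \<exists>ws. length ws = l \<and> set ws \<subseteq> S \<and> foldr (mult G) ws (one G) = g)"

definition growth :: "('a, 'b) monoid_scheme \<Rightarrow> 'a set \<Rightarrow> real \<Rightarrow> real" where
  "growth G S R = real (card {g \<in> carrier G. real (word_length G S g) \<le> R})"

definition growth_preceq :: "(real \<Rightarrow> real) \<Rightarrow> (real \<Rightarrow> real) \<Rightarrow> bool" (infix \<open>\<preceq>\<close> 50) where
  "f1 \<preceq> f2 \<longleftrightarrow> (\<exists>C\<ge>1. \<forall>R\<ge>1. f1 R \<le> f2 (C * R))"


section \<open>The space of sequences\<close>

text \<open>The letter \<open>0\<^sub>x\<close>, for \<open>x \<in> {0,1}\<close>, is \<open>L0 x\<close> with \<open>x\<close> read as a truth value, so that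
  \<open>1 - x\<close> becomes \<open>\<not> x\<close>.\<close>

datatype letter = L0 bool | L1

definition allowed_words :: "(letter \<times> letter) set" where
  "allowed_words = {(L0 False, L0 True), (L0 True, L0 False), (L0 True, L1),
     (L1, L0 False), (L1, L0 True), (L1, L1)}"

definition X :: "letter stream set" where
  "X = {s. \<forall>n. (s !! n, s !! Suc n) \<in> allowed_words}"


section \<open>The transformations\<close>

text \<open>The maps below are total on \<open>letter stream\<close>. Only their restrictions to \<open>X\<close> are used later,
  and their values on other sequences are immaterial.\<close>

fun act_a :: "letter stream \<Rightarrow> letter stream" where
  "act_a (L0 x ## w) = L1 ## w"
| "act_a (L1 ## L0 x ## w) = L0 (\<not> x) ## L0 x ## w"
| "act_a (L1 ## L1 ## w) = L0 True ## L1 ## w"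

fun act_a0 :: "letter stream \<Rightarrow> letter stream" where
  "act_a0 (L1 ## L0 True ## w) = L0 False ## L0 True ## w"
| "act_a0 (L0 False ## L0 True ## w) = L1 ## L0 True ## w"
| "act_a0 s = s"

fun act_a1 :: "letter stream \<Rightarrow> letter stream" where
  "act_a1 (L1 ## L0 False ## w) = L0 True ## L0 False ## w"
| "act_a1 (L0 True ## L0 False ## w) = L1 ## L0 False ## w"
| "act_a1 (L1 ## L1 ## w) = L0 True ## L1 ## w"
| "act_a1 (L0 True ## L1 ## w) = L1 ## L1 ## w"
| "act_a1 s = s"

text \<open>The common values of \<open>b\<close> and \<open>c\<close> on sequences that do not start with \<open>1\<close>. In \<open>X\<close>, the first
  letter is determined by the following ones, as spelled out in the lemmas \<open>act_b_eqs\<close> and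
  \<open>act_c_eqs\<close> below.\<close>

fun act_bc_zero :: "letter stream \<Rightarrow> letter stream" where
  "act_bc_zero (y ## L0 x ## w) = L0 True ## act_a (L0 x ## w)"
| "act_bc_zero (y ## L1 ## L0 x ## w) = L0 x ## act_a (L1 ## L0 x ## w)"
| "act_bc_zero (y ## L1 ## L1 ## w) = L0 False ## act_a (L1 ## L1 ## w)"

text \<open>The command \<open>primcorec\<close> does not support mutual corecursion over a single codatatype, so the
  three maps are defined as one map that takes a state.\<close>

datatype bcd = State_b | State_c | State_d

fun next_bcd :: "bcd \<Rightarrow> bcd" where
  "next_bcd State_b = State_c"
| "next_bcd State_c = State_d"
| "next_bcd State_d = State_b"

primcorec act_bcd :: "bcd \<Rightarrow> letter stream \<Rightarrow> letter stream" where
  "act_bcd q s =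
     (if shd s = L1 then L1 ## act_bcd (next_bcd q) (stl s)
      else if q = State_d then s else act_bc_zero s)"

definition act_b :: "letter stream \<Rightarrow> letter stream" where "act_b = act_bcd State_b"
definition act_c :: "letter stream \<Rightarrow> letter stream" where "act_c = act_bcd State_c"
definition act_d :: "letter stream \<Rightarrow> letter stream" where "act_d = act_bcd State_d"

lemma act_b_eqs:
  "act_b (L0 (\<not> x) ## L0 x ## w) = L0 True ## act_a (L0 x ## w)"
  "act_b (L0 True ## L1 ## L0 x ## w) = L0 x ## act_a (L1 ## L0 x ## w)"
  "act_b (L0 True ## L1 ## L1 ## w) = L0 False ## act_a (L1 ## L1 ## w)"
  "act_b (L1 ## w) = L1 ## act_c w"
  unfolding act_b_def act_c_def by (subst act_bcd.code; simp)+

lemma act_c_eqs: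
  "act_c (L0 (\<not> x) ## L0 x ## w) = L0 True ## act_a (L0 x ## w)"
  "act_c (L0 True ## L1 ## L0 x ## w) = L0 x ## act_a (L1 ## L0 x ## w)"
  "act_c (L0 True ## L1 ## L1 ## w) = L0 False ## act_a (L1 ## L1 ## w)"
  "act_c (L1 ## w) = L1 ## act_d w"
  unfolding act_c_def act_d_def by (subst act_bcd.code; simp)+

lemma act_d_eqs:
  "act_d (L0 x ## w) = L0 x ## w"
  "act_d (L1 ## w) = L1 ## act_b w"
  unfolding act_d_def act_b_def by (subst act_bcd.code; simp)+


section \<open>The group\<close>

text \<open>Transformations act from the right, so a product is evaluated from left to right, whereas
  multiplication in \<open>BijGroup\<close> is composition of functions that act from the left.\<close>

definition right_BijGroup :: "'a set \<Rightarrow> ('a \<Rightarrow> 'a) monoid" where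
  "right_BijGroup A = (BijGroup A)\<lparr>mult := \<lambda>g h. h \<otimes>\<^bsub>BijGroup A\<^esub> g\<rparr>"

definition gens :: "(letter stream \<Rightarrow> letter stream) set" where
  "gens = (\<lambda>f. restrict f X) ` {act_a0, act_a1, act_b, act_c, act_d}"

definition G_hat :: "(letter stream \<Rightarrow> letter stream) monoid" where
  "G_hat = subgroup_generated (right_BijGroup X) gens"

text \<open>Since \<open>subgroup_generated\<close> ignores generators outside of the carrier, we check that there are
  none.\<close>

lemma group_right_BijGroup: "group (right_BijGroup A)"
proof -
  interpret B: group "BijGroup A" by (rule group_BijGroup)
  show ?thesis
    by (rule groupI) (auto simp: right_BijGroup_def B.m_assoc intro: B.r_inv_ex)
qed

lemma X_Cons: "x ## y ## w \<in> X \<longleftrightarrow> (x, y) \<in> allowed_words \<and> y ## w \<in> X"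
proof -
  have "(\<forall>n. P n) \<longleftrightarrow> P 0 \<and> (\<forall>n. P (Suc n))" for P :: "nat \<Rightarrow> bool"
    by (metis not0_implies_Suc)
  from this[of "\<lambda>n. ((x ## y ## w) !! n, (x ## y ## w) !! Suc n) \<in> allowed_words"]
  show ?thesis by (simp add: X_def)
qed

lemma L1_Cons_X: "L1 ## w \<in> X \<longleftrightarrow> w \<in> X"
proof (cases w)
  case (SCons y v)
  have "(L1, y) \<in> allowed_words"
    by (cases y) (auto simp: allowed_words_def)
  then show ?thesis by (simp add: SCons X_Cons)
qed

lemma act_bc_zero_X:
  assumes "s \<in> X" "shd s \<noteq> L1"
  shows "act_bc_zero s \<in> X \<and> shd (act_bc_zero s) \<noteq> L1 \<and> act_bc_zero (act_bc_zero s) = s"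
proof -
  obtain x y z w where s: "s = x ## y ## z ## w" by (metis stream.collapse)
  show ?thesis using assms
    by (cases x; cases y; cases z) (auto simp: s X_Cons L1_Cons_X allowed_words_def)
qed

lemma act_a0_X:
  assumes "s \<in> X"
  shows "act_a0 s \<in> X \<and> act_a0 (act_a0 s) = s"
proof -
  obtain x y w where s: "s = x ## y ## w" by (metis stream.collapse)
  show ?thesis using assms
    by (cases x; cases y; cases "y = L0 True") (auto simp: s X_Cons L1_Cons_X allowed_words_def)
qed

lemma act_a1_X:
  assumes "s \<in> X"
  shows "act_a1 s \<in> X \<and> act_a1 (act_a1 s) = s"
proof -
  obtain x y w where s: "s = x ## y ## w" by (metis stream.collapse)
  show ?thesis using assms
    by (cases x; cases y; cases "y = L0 True") (auto simp: s X_Cons L1_Cons_X allowed_words_def)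
qed

lemma act_bcd_L1: "act_bcd q (L1 ## w) = L1 ## act_bcd (next_bcd q) w"
  by (subst act_bcd.code) simp

lemma act_bcd_L0:
  "shd s \<noteq> L1 \<Longrightarrow> act_bcd q s = (if q = State_d then s else act_bc_zero s)"
  by (subst act_bcd.code) simp

lemma act_bcd_X: "s \<in> X \<Longrightarrow> act_bcd q s \<in> X"
proof -
  have "s \<in> X \<Longrightarrow> (act_bcd q s !! n, act_bcd q s !! Suc n) \<in> allowed_words" for n
  proof (induction n arbitrary: q s)
    case 0
    show ?case
    proof (cases "shd s = L1")
      case True
      then show ?thesis
        by (cases "shd (act_bcd (next_bcd q) (stl s))") (auto simp: allowed_words_def)
    next
      case False
      with 0 have "act_bcd q s \<in> X" by (auto simp: act_bcd_L0 act_bc_zero_X)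
      then show ?thesis unfolding X_def by blast
    qed
  next
    case (Suc n)
    show ?case
    proof (cases "shd s = L1")
      case True
      then have s: "s = L1 ## stl s" by (metis stream.collapse)
      with Suc.prems have "stl s \<in> X" using L1_Cons_X by metis
      then have "(act_bcd (next_bcd q) (stl s) !! n, act_bcd (next_bcd q) (stl s) !! Suc n)
        \<in> allowed_words" by (rule Suc.IH)
      then show ?thesis by (subst (1 2) s) (simp add: act_bcd_L1)
    next
      case False
      with Suc.prems have "act_bcd q s \<in> X" by (auto simp: act_bcd_L0 act_bc_zero_X)
      then show ?thesis unfolding X_def by blast
    qed
  qed
  then show "s \<in> X \<Longrightarrow> act_bcd q s \<in> X" by (auto simp: X_def)
qed

lemma act_bcd_involution: "s \<in> X \<Longrightarrow> act_bcd q (act_bcd q s) = s"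
proof -
  define R where "R = (\<lambda>u v. u = v \<or> (\<exists>q. v \<in> X \<and> u = act_bcd q (act_bcd q v)))"
  have "R u v \<Longrightarrow> u = v" for u v
  proof (coinduction arbitrary: u v)
    case (Eq_stream u v)
    show ?case
    proof (cases "u = v")
      case True
      then show ?thesis by (auto simp: R_def)
    next
      case False
      with Eq_stream obtain q where v: "v \<in> X" and u: "u = act_bcd q (act_bcd q v)"
        by (auto simp: R_def)
      show ?thesis
      proof (cases "shd v = L1")
        case True
        then have vc: "v = L1 ## stl v" by (metis stream.collapse)
        with v have "stl v \<in> X" using L1_Cons_X by metis
        then have "R (stl u) (stl v)"
          unfolding R_def u by (subst vc) (auto simp: act_bcd_L1)
        moreover have "shd u = shd v" unfolding u by (subst vc) (simp add: act_bcd_L1 True)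
        ultimately show ?thesis by auto
      next
        case nL1: False
        then have "u = v"
          using act_bc_zero_X[OF v] by (auto simp: u act_bcd_L0)
        with False show ?thesis by simp
      qed
    qed
  qed
  then show "s \<in> X \<Longrightarrow> act_bcd q (act_bcd q s) = s" unfolding R_def by blast
qed

lemma gens_subset: "gens \<subseteq> carrier (right_BijGroup X)"
proof -
  have *: "restrict f X \<in> carrier (right_BijGroup X)"
    if f: "\<forall>s\<in>X. f s \<in> X \<and> f (f s) = s" for f
  proof -
    have "bij_betw f X X"
      using f by (intro bij_betwI[where g = f]) blast+
    then show ?thesis
      by (simp add: right_BijGroup_def BijGroup_def Bij_def cong: bij_betw_cong)
  qed
  have "\<forall>s\<in>X. act_bcd q s \<in> X \<and> act_bcd q (act_bcd q s) = s" for q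
    by (intro ballI conjI act_bcd_X act_bcd_involution)
  then have bcd: "restrict (act_bcd q) X \<in> carrier (right_BijGroup X)" for q
    by (rule *)
  have "restrict act_a0 X \<in> carrier (right_BijGroup X)"
    by (rule *) (intro ballI act_a0_X)
  moreover have "restrict act_a1 X \<in> carrier (right_BijGroup X)"
    by (rule *) (intro ballI act_a1_X)
  ultimately show ?thesis
    using bcd unfolding gens_def act_b_def act_c_def act_d_def by blast
qed

end

theory Submission
  imports Defs
begin

text \<open>
Write \<open>1w\<close> and \<open>0w\<close> for the sequence \<open>w\<close> with one letter put in front, where the index of \<open>0\<close> is the
  one that the space \<open>X\<close> forces. In this notation \<open>a = a\<^sub>0a\<^sub>1\<close> exchanges \<open>0w\<close> and \<open>1w\<close>, and \<open>b, c, d\<close> act as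
  in the first Grigorchuk group. The Schreier graphs are therefore linear: locally they are paths
  whose edges carry in turn a label \<open>a\<^sub>0\<close> or \<open>a\<^sub>1\<close> and a label \<open>{b, c, d} - {m}\<close>. Given \<open>n\<close>, the points
  \<open>vw\<close> with \<open>|v| = n\<close> form a segment that begins with \<open>1\<^sup>nw\<close>. All its labels are independent of \<open>w\<close>
  except for that of the edge between \<open>00\<dots>0w\<close> and \<open>10\<dots>0w\<close>, which is \<open>a\<^sub>0\<close> or \<open>a\<^sub>1\<close> depending on \<open>w\<close>. The tile \<open>K\<^sub>n\<close> is the part of the segment from \<open>1\<^sup>nw\<close> to
  this edge. The tiles satisfy
  \<open>K\<^sub>n\<^sub>+\<^sub>2 = K\<^sub>n\<^sub>+\<^sub>1 \<cdot> e \<cdot> K\<^sub>n\<^sup>-\<^sup>1 \<cdot> ({b, c, d} - {m\<^sub>n}) \<cdot> K\<^sub>n\<close>, where \<open>e\<close> is an edge with a fixed label \<open>a\<^sub>0\<close> or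
  \<open>a\<^sub>1\<close> and where \<open>m\<^sub>n\<close> runs periodically through \<open>d, c, b\<close>.

  Let a word of length \<open>R\<close> act, and let \<open>N\<^sub>n\<close> be the number of times at which it completes a traversal of
  \<open>K\<^sub>n\<close> that was begun at some earlier time. The key inequality is
  \<open>N\<^sub>n\<^sub>+\<^sub>2 + N\<^sub>n\<^sub>+\<^sub>3 + N\<^sub>n\<^sub>+\<^sub>4 \<le> 2N\<^sub>n\<close> (\<open>tile_recurrence\<close>). A traversal of \<open>K\<^sub>n\<^sub>+\<^sub>2\<close>, \<open>K\<^sub>n\<^sub>+\<^sub>3\<close> or \<open>K\<^sub>n\<^sub>+\<^sub>4\<close>
  contains one of \<open>K\<^sub>n\<^sup>-\<^sup>1 \<cdot> ({b, c, d} - {m}) \<cdot> K\<^sub>n\<close>, for three different \<open>m\<close>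
  (\<open>card_trav_ends_subpath\<close>). Folding this path in the middle gives the same walk on \<open>K\<^sub>n\<close> for all three
  \<open>m\<close>, and the walk changes sides if and only if the product in the Klein group \<open>{1, b, c, d}\<close> of the
  letters read at the fold is neither \<open>1\<close> nor \<open>m\<close>. So a traversal of \<open>K\<^sub>n\<close> is the last part of a crossing
  for at most two of the three \<open>m\<close> (\<open>three_joints\<close>). Since \<open>\<eta>\<close> is the positive root of
  \<open>x\<^sup>4 + x\<^sup>3 + x\<^sup>2 = 2\<close>, it follows that \<open>N\<^sub>n = O(R\<eta>\<^sup>n)\<close> (\<open>eta_decay\<close>).

  A trajectory of the word is a sequence of stays near the place where a few tiles meet, separated by
  traversals of tiles. What happens during a stay depends only on its starting time and on finitely
  many possibilities for the labels nearby. Hence the transformation is determined by a table with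
  \<open>O(2\<^sup>n + N)\<close> entries, each with \<open>(2\<^sup>n + N)\<^sup>O\<^sup>(\<^sup>1\<^sup>)\<close> possible values, where \<open>N = O(R\<eta>\<^sup>n)\<close> bounds the number
  of traversals (\<open>portrait_determines\<close>); only the order of the completion times enters the table, not
  their values. With \<open>2\<^sup>n \<approx> R\<eta>\<^sup>n\<close>, both terms are about \<open>R\<^sup>\<beta>\<close> for
  \<open>\<beta> = log 2 / (log 2 - log \<eta>)\<close>, so there are at most \<open>exp(O(R\<^sup>\<beta> log R))\<close> tables, and the logarithm is
  absorbed by any \<open>\<alpha> > \<beta>\<close>.
\<close>

section \<open>Traversals of labelled paths\<close>

datatype gen = Ga0 | Ga1 | Gb | Gc | Gd

definition "A_gens = {Ga0, Ga1}"
definition "B_gens = {Gb, Gc, Gd}"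

lemma B_gens_compl: "B_gens = - A_gens"
proof -
  have "s \<in> B_gens \<longleftrightarrow> s \<notin> A_gens" for s by (cases s) (auto simp: A_gens_def B_gens_def)
  then show ?thesis by blast
qed

text \<open>A path is given by the list of its edge labels; its vertices are \<open>0, \<dots>, length P\<close>. A letter moves along
  an edge that carries it and fixes the vertex otherwise. In particular, the walk is reflected at the
  two ends, so statements about orbits use \<open>step\<close> only as long as the ends are not reached.\<close>

definition step :: "gen set list \<Rightarrow> gen \<Rightarrow> nat \<Rightarrow> nat" where
  "step P s p =
     (if p < length P \<and> s \<in> P ! p then Suc p
      else if 0 < p \<and> p \<le> length P \<and> s \<in> P ! (p - 1) then p - 1 else p)"

text \<open>The condition that makes every letter act as an involution, and hence walks reversible.\<close>

definition proper :: "gen set list \<Rightarrow> bool" where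
  "proper P \<longleftrightarrow> successively (\<lambda>e e'. e \<inter> e' = {}) P"

lemma step_upper: "step P s p \<le> Suc p"
  by (auto simp: step_def)

lemma step_le_length: "p \<le> length P \<Longrightarrow> step P s p \<le> length P"
  by (auto simp: step_def)

lemma proper_nth: "proper P \<Longrightarrow> Suc k < length P \<Longrightarrow> P ! k \<inter> P ! Suc k = {}"
  unfolding proper_def by (auto dest: successively_nth)

lemma step_involution:
  assumes "proper P" "p \<le> length P"
  shows "step P s (step P s p) = p"
proof -
  have *: "P ! (p - 1) \<inter> P ! p = {}" if "0 < p" "p < length P"
    using proper_nth[OF assms(1), of "p - 1"] that by simp
  have **: "P ! p \<inter> P ! Suc p = {}" if "Suc p < length P"
    using proper_nth[OF assms(1)] that by simp
  show ?thesis using assms(2) * ** by (auto simp: step_def)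
qed

lemma step_rev:
  assumes "proper P" "p \<le> length P"
  shows "step (rev P) s (length P - p) = length P - step P s p"
proof -
  have *: "P ! (p - 1) \<inter> P ! p = {}" if "0 < p" "p < length P"
    using proper_nth[OF assms(1), of "p - 1"] that by simp
  show ?thesis
    using assms(2) * by (auto simp: step_def rev_nth Suc_diff_le)
qed

lemma step_inner:
  assumes "length A < p" "p < length A + length Q"
  shows "step (A @ Q @ B) s p = length A + step Q s (p - length A)"
  using assms by (auto simp: step_def nth_append)

lemma step_enter:
  assumes "step (A @ Q @ B) s (length A) = Suc (length A)" "Q \<noteq> []"
  shows "step Q s 0 = 1"
  using assms by (auto simp: step_def nth_append split: if_splits)

definition walk :: "gen set list \<Rightarrow> (nat \<Rightarrow> gen) \<Rightarrow> (nat \<Rightarrow> nat) \<Rightarrow> nat \<Rightarrow> nat \<Rightarrow> bool" where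
  "walk P ws q i j \<longleftrightarrow> (\<forall>t. i \<le> t \<and> t < j \<longrightarrow> q (Suc t) = step P (ws t) (q t))"

text \<open>The walk may have been anywhere before time \<open>i\<close>. So many traversals, starting at different
  vertices of the Schreier graph, are in progress at the same time.\<close>

definition traversal :: "gen set list \<Rightarrow> (nat \<Rightarrow> gen) \<Rightarrow> (nat \<Rightarrow> nat) \<Rightarrow> nat \<Rightarrow> nat \<Rightarrow> bool" where
  "traversal P ws q i j \<longleftrightarrow> i < j \<and> walk P ws q i j \<and> q i = 0 \<and> q j = length P \<and>
     (\<forall>t. i < t \<and> t < j \<longrightarrow> 0 < q t \<and> q t < length P)"

text \<open>On proper paths walks are deterministic in both time directions, so that a traversal is determined
  by the time at which it ends. This is why counting end times amounts to counting traversals.\<close>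

definition trav_ends :: "gen set list \<Rightarrow> (nat \<Rightarrow> gen) \<Rightarrow> nat \<Rightarrow> nat set" where
  "trav_ends P ws R = {j. j \<le> R \<and> (\<exists>q i. traversal P ws q i j)}"

lemma finite_trav_ends [simp]: "finite (trav_ends P ws R)"
  by (rule finite_subset[of _ "{..R}"]) (auto simp: trav_ends_def)

lemma card_trav_ends_le: "card (trav_ends P ws R) \<le> R"
proof -
  have "trav_ends P ws R \<subseteq> {1..R}" by (auto simp: trav_ends_def traversal_def)
  then have "card (trav_ends P ws R) \<le> card {1..R}" by (intro card_mono) auto
  then show ?thesis by simp
qed

lemma walk_subset: "walk P ws q i j \<Longrightarrow> i \<le> i' \<Longrightarrow> j' \<le> j \<Longrightarrow> walk P ws q i' j'"
  by (auto simp: walk_def)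

lemma walk_determined:
  assumes "walk P ws q i j" "walk P ws q' i j" "q i = q' i" "i \<le> t" "t \<le> j"
  shows "q t = q' t"
  using assms(4,5)
proof (induction t rule: dec_induct)
  case base then show ?case using assms by simp
next
  case (step n) then show ?case using assms(1,2) by (simp add: walk_def)
qed

text \<open>A walk that reaches the far end of \<open>Q\<close> from before \<open>Q\<close> traverses \<open>Q\<close> after its last visit to the
  near end.\<close>

lemma last_exit:
  assumes w: "walk (A @ Q @ B) ws q t u" and "t \<le> u"
    and start: "q t \<le> length A" and fin: "q u = length A + length Q" and "Q \<noteq> []"
    and below: "\<And>v. t \<le> v \<Longrightarrow> v < u \<Longrightarrow> q v < length A + length Q"
  shows "\<exists>q' i. t \<le> i \<and> traversal Q ws q' i u"
proof -
  let ?a = "length A"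
  define i where "i = Max {v. t \<le> v \<and> v \<le> u \<and> q v \<le> ?a}"
  have f: "finite {v. t \<le> v \<and> v \<le> u \<and> q v \<le> ?a}"
    by (rule finite_subset[of _ "{..u}"]) auto
  have "i \<in> {v. t \<le> v \<and> v \<le> u \<and> q v \<le> ?a}"
    unfolding i_def using f start \<open>t \<le> u\<close> by (intro Max_in) auto
  then have i: "t \<le> i" "i \<le> u" "q i \<le> ?a" by auto
  have after: "?a < q v" if "i < v" "v \<le> u" for v
  proof (rule ccontr)
    assume "\<not> ?a < q v"
    then have "v \<in> {v. t \<le> v \<and> v \<le> u \<and> q v \<le> ?a}" using that i by auto
    then have "v \<le> i" unfolding i_def using f by simp
    then show False using that by simp
  qed
  have "i < u" using i(2,3) fin \<open>Q \<noteq> []\<close> by (cases "i = u") auto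
  then have s: "q (Suc i) = step (A @ Q @ B) (ws i) (q i)" using w i by (auto simp: walk_def)
  then have "q (Suc i) \<le> Suc (q i)" by (simp add: step_upper)
  moreover have "?a < q (Suc i)" using after[of "Suc i"] \<open>i < u\<close> by simp
  ultimately have qi: "q i = ?a" "q (Suc i) = Suc ?a" using i(3) by auto
  have "walk Q ws (\<lambda>v. q v - ?a) i u"
    unfolding walk_def
  proof (intro allI impI)
    fix v assume v: "i \<le> v \<and> v < u"
    show "q (Suc v) - ?a = step Q (ws v) (q v - ?a)"
    proof (cases "v = i")
      case True
      then show ?thesis using step_enter[of A Q B "ws i"] s qi \<open>Q \<noteq> []\<close> by simp
    next
      case False
      then have "?a < q v" "q v < ?a + length Q" using after[of v] below[of v] v i by auto
      moreover have "q (Suc v) = step (A @ Q @ B) (ws v) (q v)" using w v i by (auto simp: walk_def)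
      ultimately show ?thesis by (simp add: step_inner)
    qed
  qed
  moreover have "0 < q v - ?a \<and> q v - ?a < length Q" if "i < v" "v < u" for v
    using after[of v] below[of v] that i by auto
  ultimately have "traversal Q ws (\<lambda>v. q v - ?a) i u"
    using \<open>i < u\<close> qi fin by (auto simp: traversal_def)
  then show ?thesis using i by blast
qed

text \<open>A traversal of a long path is sent to the time at which it first reaches the far end of \<open>Q\<close>, which
  ends a traversal of \<open>Q\<close>. The map is injective: from this time on the walk is determined, and so is
  the time at which the long path is completed.\<close>

lemma card_trav_ends_subpath:
  assumes "Q \<noteq> []"
  shows "card (trav_ends (A @ Q @ B) ws R) \<le> card (trav_ends Q ws R)"
proof -
  let ?P = "A @ Q @ B" and ?b = "length A + length Q"
  have "\<exists>T. T \<in> trav_ends Q ws R \<and> T \<le> j \<and> (\<exists>q. walk ?P ws q T j \<and> q T = ?b \<and> q j = length ?P \<and>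
      (\<forall>v. T \<le> v \<and> v < j \<longrightarrow> q v < length ?P))"
    if "j \<in> trav_ends ?P ws R" for j
  proof -
    from that obtain q i where j: "j \<le> R" and tr: "traversal ?P ws q i j"
      by (auto simp: trav_ends_def)
    note tr = tr[unfolded traversal_def]
    define T where "T = (LEAST v. i \<le> v \<and> ?b \<le> q v)"
    have ex: "i \<le> j \<and> ?b \<le> q j" using tr by auto
    have T: "i \<le> T" "?b \<le> q T" unfolding T_def using LeastI[of "\<lambda>v. i \<le> v \<and> ?b \<le> q v", OF ex] by auto
    have "T \<le> j" unfolding T_def by (rule Least_le[of "\<lambda>v. i \<le> v \<and> ?b \<le> q v", OF ex])
    have below: "q v < ?b" if "i \<le> v" "v < T" for v
      using not_less_Least[of v "\<lambda>v. i \<le> v \<and> ?b \<le> q v"] that unfolding T_def by auto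
    have "T \<noteq> i" using T tr assms by auto
    then obtain T' where T': "T = Suc T'" "i \<le> T'" using T(1) by (cases T) auto
    have "q T = step ?P (ws T') (q T')" using tr T' \<open>T \<le> j\<close> by (auto simp: walk_def)
    then have "q T \<le> Suc (q T')" by (simp add: step_upper)
    then have qT: "q T = ?b" using below[of T'] T T' by simp
    have "\<exists>q' i'. i \<le> i' \<and> traversal Q ws q' i' T"
      by (rule last_exit[of A Q B ws q i T])
        (use tr qT T below assms \<open>T \<le> j\<close> in \<open>auto simp: walk_def\<close>)
    then have "T \<in> trav_ends Q ws R" using \<open>T \<le> j\<close> j by (auto simp: trav_ends_def)
    moreover have "walk ?P ws q T j" using tr T by (auto simp: walk_def)
    moreover have "\<forall>v. T \<le> v \<and> v < j \<longrightarrow> q v < length ?P" using tr T \<open>T \<noteq> i\<close> by auto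
    ultimately show ?thesis using \<open>T \<le> j\<close> qT tr by blast
  qed
  then obtain T where T: "\<And>j. j \<in> trav_ends ?P ws R \<Longrightarrow> T j \<in> trav_ends Q ws R \<and> T j \<le> j \<and>
      (\<exists>q. walk ?P ws q (T j) j \<and> q (T j) = ?b \<and> q j = length ?P \<and>
      (\<forall>v. T j \<le> v \<and> v < j \<longrightarrow> q v < length ?P))" by metis
  have not_less: "\<not> j < j'"
    if jj: "j \<in> trav_ends ?P ws R" "j' \<in> trav_ends ?P ws R" "T j = T j'" for j j'
  proof
    assume "j < j'"
    from T[OF jj(1)] obtain q where q: "T j \<le> j" "walk ?P ws q (T j) j" "q (T j) = ?b" "q j = length ?P"
      by blast
    from T[OF jj(2)] obtain q' where q': "walk ?P ws q' (T j) j'" "q' (T j) = ?b"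
      "\<forall>v. T j \<le> v \<and> v < j' \<longrightarrow> q' v < length ?P" using jj(3) by auto
    have "q j = q' j"
      by (rule walk_determined[of ?P ws q "T j" j q'])
        (use q q' \<open>j < j'\<close> in \<open>auto intro: walk_subset\<close>)
    then show False using q q' \<open>j < j'\<close> by auto
  qed
  show ?thesis
  proof (rule card_inj_on_le[of T])
    show "inj_on T (trav_ends ?P ws R)" by (intro inj_onI) (metis not_less linorder_neqE_nat)
    show "T ` trav_ends ?P ws R \<subseteq> trav_ends Q ws R" using T by blast
  qed simp
qed

text \<open>Two copies of \<open>K\<close> glued at their initial vertices by an edge that the letter \<open>m\<close> does not move along.\<close>

definition joined :: "gen \<Rightarrow> gen set list \<Rightarrow> gen set list" where
  "joined m K = rev K @ [B_gens - {m}] @ K"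

lemma length_joined [simp]: "length (joined m K) = 2 * length K + 1"
  by (simp add: joined_def)

lemma nth_joined:
  "p < 2 * length K + 1 \<Longrightarrow> joined m K ! p = (if p < length K then K ! (length K - 1 - p)
     else if p = length K then B_gens - {m} else K ! (p - length K - 1))"
  by (auto simp: joined_def nth_append rev_nth nth_Cons')

text \<open>The distance to the middle edge, for a path that consists of two copies of a path of length \<open>L\<close>.\<close>

definition fold_pos :: "nat \<Rightarrow> nat \<Rightarrow> nat" where
  "fold_pos L p = (if p \<le> L then L - p else p - L - 1)"

context
  fixes K :: "gen set list"
  assumes K: "K \<noteq> []" "hd K \<inter> B_gens = {}" "proper K"
begin

lemma K0: "K ! 0 \<inter> B_gens = {}" using K by (simp add: hd_conv_nth)

text \<open>The folded walk does not depend on \<open>m\<close>: crossing the middle edge and staying in front of it look the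
  same after folding.\<close>

lemma step_fold:
  assumes "p \<le> 2 * length K + 1"
  shows "step K s (fold_pos (length K) p) = fold_pos (length K) (step (joined m K) s p)"
proof -
  let ?L = "length K"
  have pr: "K ! k \<inter> K ! Suc k = {}" if "Suc k < ?L" for k using proper_nth K that by blast
  have L: "0 < ?L" using K by simp
  consider "p < ?L" | "p = ?L" | "p = Suc ?L" | "p > Suc ?L" by linarith
  then show ?thesis
  proof cases
    case 1
    have "K ! (?L - p - 1) \<inter> K ! (?L - p) = {}" if "0 < p"
      using pr[of "?L - p - 1"] that 1 by (simp add: Suc_diff_Suc)
    then show ?thesis using 1 L
      by (auto simp: step_def nth_joined fold_pos_def Suc_diff_Suc)
  next
    case 2
    obtain l where "?L = Suc l" using L gr0_implies_Suc by blast
    then show ?thesis using 2 K0 by (auto simp: step_def nth_joined fold_pos_def)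
  next
    case 3
    then show ?thesis using L K0 by (auto simp: step_def nth_joined fold_pos_def)
  next
    case 4
    then obtain r where r: "p = Suc (Suc (?L + r))" using less_imp_Suc_add[of "Suc ?L" p] by auto
    then have "r < ?L" using assms by simp
    then show ?thesis by (auto simp: r step_def nth_joined fold_pos_def)
  qed
qed

lemma step_side:
  assumes "p \<le> 2 * length K + 1"
  shows "step (joined m K) s p > length K \<longleftrightarrow>
    (p > length K) \<noteq> (fold_pos (length K) p = 0 \<and> s \<in> B_gens - {m})"
proof -
  let ?L = "length K"
  have L: "0 < ?L" using K by simp
  consider "p < ?L" | "p = ?L" | "p = Suc ?L" | "p > Suc ?L" by linarith
  then show ?thesis
    using L K0 assms by cases (auto simp: step_def nth_joined fold_pos_def)
qed

text \<open>Going back in time from \<open>j\<close>, the three folded walks agree, so the three crossings also begin at the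
  same time. Each of the letters \<open>b, c, d\<close>, when read at the fold, changes sides in exactly two of the
  three paths. So the number of paths in which the walk is on the right has constant parity: it cannot
  grow from \<open>0\<close> to \<open>3\<close>.\<close>

lemma no_common_trav_end:
  assumes "j \<in> trav_ends (joined Gb K) ws R" "j \<in> trav_ends (joined Gc K) ws R"
    "j \<in> trav_ends (joined Gd K) ws R"
  shows False
proof -
  let ?L = "length K"
  have le: "q t \<le> 2 * ?L + 1" if "traversal (joined m K) ws q i j" "i \<le> t" "t \<le> j" for q m i t
    using that unfolding traversal_def
    by (cases "t = i"; cases "t = j") (auto simp: less_imp_le)
  have agree: "fold_pos ?L (q t) = fold_pos ?L (q' t)"
    if tr: "traversal (joined m K) ws q i j" "traversal (joined m' K) ws q' i' j"
      and t: "i \<le> t" "i' \<le> t" "t \<le> j" for q m i t q' m' i'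
    using t(3,1,2)
  proof (induction t rule: inc_induct)
    case base
    then show ?case using tr by (simp add: traversal_def)
  next
    case (step t)
    have s: "q (Suc t) = step (joined m K) (ws t) (q t)" "q' (Suc t) = step (joined m' K) (ws t) (q' t)"
      using tr step by (auto simp: traversal_def walk_def)
    have b: "q t \<le> 2 * ?L + 1" "q' t \<le> 2 * ?L + 1"
      using le[OF tr(1), of t] le[OF tr(2), of t] step by auto
    have "step K (ws t) (fold_pos ?L (q t)) = step K (ws t) (fold_pos ?L (q' t))"
      using step s step_fold[OF b(1), where m = m] step_fold[OF b(2), where m = m'] by simp
    moreover have "fold_pos ?L (q t) \<le> ?L" "fold_pos ?L (q' t) \<le> ?L"
      using b by (auto simp: fold_pos_def)
    ultimately show ?case using step_involution[OF K(3)] by metis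
  qed
  have not_less: "\<not> i < i'"
    if tr: "traversal (joined m K) ws q i j" "traversal (joined m' K) ws q' i' j" for q m i q' m' i'
  proof
    assume "i < i'"
    have "i' < j" using tr by (simp add: traversal_def)
    have "fold_pos ?L (q i') = fold_pos ?L (q' i')" by (rule agree[OF tr]) (use \<open>i < i'\<close> \<open>i' < j\<close> in auto)
    moreover have "q' i' = 0" "0 < q i'" "q i' < 2 * ?L + 1"
      using tr \<open>i < i'\<close> \<open>i' < j\<close> by (auto simp: traversal_def)
    ultimately show False by (auto simp: fold_pos_def split: if_splits)
  qed
  obtain qb ib qc ic qd jd where
    tr: "traversal (joined Gb K) ws qb ib j" "traversal (joined Gc K) ws qc ic j"
      "traversal (joined Gd K) ws qd jd j"
    using assms by (auto simp: trav_ends_def)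
  have eq: "ic = ib" "jd = ib"
    using not_less[OF tr(1,2)] not_less[OF tr(2,1)] not_less[OF tr(1,3)] not_less[OF tr(3,1)] by auto
  note tr = tr[unfolded eq]
  have "ib < j" using tr by (simp add: traversal_def)
  have "(qb t > ?L) \<noteq> ((qc t > ?L) = (qd t > ?L))" if "ib \<le> t" "t \<le> j" for t
    using that
  proof (induction t rule: dec_induct)
    case base
    then show ?case using tr by (auto simp: traversal_def)
  next
    case (step t)
    have "fold_pos ?L (qb t) = fold_pos ?L (qc t)" "fold_pos ?L (qb t) = fold_pos ?L (qd t)"
      using agree[OF tr(1,2)] agree[OF tr(1,3)] step by auto
    moreover have "qb (Suc t) = step (joined Gb K) (ws t) (qb t)"
      "qc (Suc t) = step (joined Gc K) (ws t) (qc t)"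
      "qd (Suc t) = step (joined Gd K) (ws t) (qd t)"
      using tr step by (auto simp: traversal_def walk_def)
    moreover have "qb t \<le> 2 * ?L + 1" "qc t \<le> 2 * ?L + 1" "qd t \<le> 2 * ?L + 1"
      using le[OF tr(1), of t] le[OF tr(2), of t] le[OF tr(3), of t] step by auto
    ultimately show ?case using step
      by (cases "ws t") (auto simp: step_side B_gens_def)
  qed
  from this[of j] show False using tr \<open>ib < j\<close> by (auto simp: traversal_def)
qed

lemma trav_ends_joined: "trav_ends (joined m K) ws R \<subseteq> trav_ends K ws R"
proof
  fix j assume "j \<in> trav_ends (joined m K) ws R"
  then obtain q i where "j \<le> R" and tr: "traversal (joined m K) ws q i j" by (auto simp: trav_ends_def)
  have "\<exists>q' i'. i \<le> i' \<and> traversal K ws q' i' j"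
    by (rule last_exit[of "rev K @ [B_gens - {m}]" K "[]" ws q i j])
      (use tr K in \<open>auto simp: traversal_def joined_def le_less\<close>)
  then show "j \<in> trav_ends K ws R" using \<open>j \<le> R\<close> by (auto simp: trav_ends_def)
qed

lemma three_joints:
  "card (trav_ends (joined Gb K) ws R) + card (trav_ends (joined Gc K) ws R)
     + card (trav_ends (joined Gd K) ws R) \<le> 2 * card (trav_ends K ws R)"
proof -
  let ?E = "\<lambda>m. trav_ends (joined m K) ws R" and ?F = "trav_ends K ws R"
  have "?E Gd \<subseteq> ?F - ?E Gb \<inter> ?E Gc"
    using no_common_trav_end trav_ends_joined by blast
  then have "card (?E Gd) \<le> card (?F - ?E Gb \<inter> ?E Gc)" by (intro card_mono) auto
  also have "\<dots> = card ?F - card (?E Gb \<inter> ?E Gc)"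
    using trav_ends_joined by (intro card_Diff_subset) auto
  finally have 1: "card (?E Gd) \<le> card ?F - card (?E Gb \<inter> ?E Gc)" .
  have 2: "card (?E Gb \<inter> ?E Gc) \<le> card ?F"
    using trav_ends_joined[of Gb] by (intro card_mono) auto
  have 3: "card (?E Gb) + card (?E Gc) = card (?E Gb \<union> ?E Gc) + card (?E Gb \<inter> ?E Gc)"
    by (rule card_Un_Int) auto
  have 4: "card (?E Gb \<union> ?E Gc) \<le> card ?F"
    using trav_ends_joined[of Gb] trav_ends_joined[of Gc] by (intro card_mono) auto
  show ?thesis using 1 2 3 4 by linarith
qed

end

section \<open>The tiles and the decay of their traversals\<close>

text \<open>The one letter among \<open>b, c, d\<close> that reaches the state \<open>d\<close>, and so acts trivially, after it has passed
  through \<open>k\<close> letters \<open>1\<close>; see \<open>next_missing\<close>.\<close>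

fun missing :: "nat \<Rightarrow> gen" where
  "missing 0 = Gd"
| "missing (Suc k) = (if missing k = Gd then Gc else if missing k = Gc then Gb else Gd)"

text \<open>The tile \<open>K\<^sub>n\<close>. It has no edge for \<open>n = 1\<close> either, because the only edge between \<open>1w\<close> and \<open>0w\<close> has an
  undetermined label.\<close>

fun tile :: "nat \<Rightarrow> gen set list" where
  "tile 0 = []"
| "tile (Suc 0) = []"
| "tile (Suc (Suc n)) =
     tile (Suc n) @ [{if odd n then Ga0 else Ga1}] @ joined (missing n) (tile n)"

lemma missing_B: "missing k \<in> B_gens"
  by (cases k) (auto simp: B_gens_def)

lemma proper_append:
  "proper (P @ Q) \<longleftrightarrow> proper P \<and> proper Q \<and> (P \<noteq> [] \<longrightarrow> Q \<noteq> [] \<longrightarrow> last P \<inter> hd Q = {})"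
  by (auto simp: proper_def successively_append_iff)

lemma proper_Cons: "proper (e # P) \<longleftrightarrow> proper P \<and> (P \<noteq> [] \<longrightarrow> e \<inter> hd P = {})"
  by (auto simp: proper_def successively_Cons)

lemma proper_rev [simp]: "proper (rev P) \<longleftrightarrow> proper P"
  by (simp add: proper_def successively_rev Int_commute)

lemma proper_Nil [simp]: "proper []"
  by (simp add: proper_def)

lemma A_B_disjoint: "e \<subseteq> A_gens \<Longrightarrow> e' \<subseteq> B_gens \<Longrightarrow> e \<inter> e' = {} \<and> e' \<inter> e = {}"
  by (auto simp: B_gens_compl)

lemma tile_ends:
  "tile n \<noteq> [] \<Longrightarrow> hd (tile n) \<subseteq> A_gens \<and> last (tile n) \<subseteq> B_gens"
  by (induction n rule: tile.induct) (auto simp: joined_def A_gens_def hd_append last_append)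

lemma proper_joined:
  assumes "proper K" "K \<noteq> [] \<Longrightarrow> hd K \<subseteq> A_gens"
  shows "proper (joined m K)"
proof -
  have "K \<noteq> [] \<Longrightarrow> hd K \<inter> (B_gens - {m}) = {} \<and> (B_gens - {m}) \<inter> hd K = {}"
    using assms(2) by (auto simp: B_gens_compl)
  then show ?thesis using assms(1)
    by (auto simp: joined_def proper_append proper_Cons last_rev)
qed

lemma proper_tile: "proper (tile n)"
proof (induction n rule: tile.induct)
  case (3 n)
  have s: "{if odd n then Ga0 else Ga1} \<subseteq> A_gens" by (auto simp: A_gens_def)
  have "hd (joined (missing n) (tile n)) \<subseteq> B_gens"
    using tile_ends[of n] by (cases "tile n = []") (auto simp: joined_def hd_append hd_rev)
  with s have 1: "{if odd n then Ga0 else Ga1} \<inter> hd (joined (missing n) (tile n)) = {}"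
    using A_B_disjoint by blast
  have 2: "last (tile (Suc n)) \<inter> {if odd n then Ga0 else Ga1} = {}" if "tile (Suc n) \<noteq> []"
    using A_B_disjoint[OF s] tile_ends[OF that] by blast
  have "joined (missing n) (tile n) \<noteq> []" by (simp add: joined_def)
  moreover have "proper (joined (missing n) (tile n))"
    using 3 tile_ends by (intro proper_joined) auto
  ultimately show ?case using 3 1 2
    by (auto simp: proper_append proper_Cons simp del: One_nat_def)
qed auto

lemma tile_nonempty: "tile (Suc (Suc n)) \<noteq> []"
  by simp

lemma tile_prefix: "\<exists>B. tile (Suc n) = tile n @ B"
  by (cases n) auto

lemma length_tile: "Suc (length (tile n)) \<le> 2 ^ n"
  by (induction n rule: tile.induct) auto

lemma joined_prefix: "joined m (K @ B) = rev B @ joined m K @ B"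
  by (simp add: joined_def)

lemma joined_nonempty: "joined m K \<noteq> []"
  by (simp add: joined_def)

lemma missing_cycle:
  "f (missing n) + f (missing (Suc n)) + f (missing (Suc (Suc n))) = f Gb + f Gc + (f Gd :: nat)"
  using missing_B[of n] by (auto simp: B_gens_def)

lemma trav_ends_tile_joined:
  "card (trav_ends (tile (Suc (Suc n))) ws R) \<le> card (trav_ends (joined (missing n) (tile n)) ws R)"
  using card_trav_ends_subpath[OF joined_nonempty, of "tile (Suc n) @ [{if odd n then Ga0 else Ga1}]" _ _ "[]"]
  by simp

lemma trav_ends_joined_prefix:
  "card (trav_ends (joined m (K @ B)) ws R) \<le> card (trav_ends (joined m K) ws R)"
  unfolding joined_prefix by (rule card_trav_ends_subpath[OF joined_nonempty])

text \<open>Since \<open>K\<^sub>n\<close> is a prefix of \<open>K\<^sub>n\<^sub>+\<^sub>1\<close> and \<open>K\<^sub>n\<^sub>+\<^sub>2\<close>, the middle of the tiles of level \<open>n + 2\<close>, \<open>n + 3\<close> and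
  \<open>n + 4\<close> contains two copies of \<open>K\<^sub>n\<close>, glued along edges with three different missing letters.\<close>

lemma tile_recurrence:
  fixes ws R defines "N \<equiv> \<lambda>n. card (trav_ends (tile n) ws R)"
  assumes "n \<ge> 2"
  shows "N (n + 2) + N (n + 3) + N (n + 4) \<le> 2 * N n"
proof -
  let ?J = "\<lambda>m. card (trav_ends (joined m (tile n)) ws R)"
  have ne: "tile n \<noteq> []" using assms(2) tile_nonempty by (metis One_nat_def Suc_1 add_2_eq_Suc' le_add_diff_inverse2)
  obtain B where B: "tile (Suc n) = tile n @ B" using tile_prefix by blast
  obtain B' where B': "tile (Suc (Suc n)) = tile n @ B'" using tile_prefix[of "Suc n"] B by auto
  have "N (n + 2) \<le> ?J (missing n)"
    using trav_ends_tile_joined[of n] by (simp add: N_def)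
  moreover have "N (n + 3) \<le> ?J (missing (Suc n))"
    using trav_ends_tile_joined[of "Suc n" ws R] trav_ends_joined_prefix[of "missing (Suc n)" "tile n" B ws R]
    unfolding N_def B by (simp add: numeral_3_eq_3)
  moreover have "N (n + 4) \<le> ?J (missing (Suc (Suc n)))"
    using trav_ends_tile_joined[of "Suc (Suc n)" ws R]
      trav_ends_joined_prefix[of "missing (Suc (Suc n))" "tile n" B' ws R]
    unfolding N_def B' by (simp add: numeral_eq_Suc)
  moreover have "?J Gb + ?J Gc + ?J Gd \<le> 2 * N n"
    unfolding N_def using tile_ends[OF ne] proper_tile ne
    by (intro three_joints) (auto simp: B_gens_compl)
  ultimately show ?thesis using missing_cycle[of ?J n] by linarith
qed

text \<open>The reversed tile also contains \<open>K\<^sub>n\<close> itself, so traversals in the opposite direction need no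
  separate recurrence.\<close>

lemma trav_ends_rev_tile:
  assumes "n \<ge> 2"
  shows "card (trav_ends (rev (tile (n + 2))) ws R) \<le> card (trav_ends (tile n) ws R)"
proof -
  have ne: "tile n \<noteq> []" using assms tile_nonempty by (metis One_nat_def Suc_1 add_2_eq_Suc' le_add_diff_inverse2)
  have "rev (tile (n + 2)) = (rev (tile n) @ [B_gens - {missing n}]) @ tile n @
      ([{if odd n then Ga0 else Ga1}] @ rev (tile (Suc n)))"
    by (simp add: joined_def)
  then show ?thesis using card_trav_ends_subpath[OF ne] by metis
qed

text \<open>The recurrence has its leading terms on the smaller side, so it bounds no single \<open>N\<^sub>n\<close> by induction.
  It does so for the combination \<open>V\<close> below, whose coefficients are those of
  \<open>(x\<^sup>4 + x\<^sup>3 + x\<^sup>2 - 2) / (x - \<eta>)\<close>: they are positive and give \<open>V\<^sub>n\<^sub>+\<^sub>1 \<le> \<eta> V\<^sub>n\<close>. The shift by \<open>2\<close> skips the two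
  levels where the tile has no edge.\<close>

lemma eta_decay:
  fixes \<eta> :: real
  assumes \<eta>: "\<eta> > 0" "\<eta> ^ 4 + \<eta> ^ 3 + \<eta> ^ 2 - 2 = 0" and "n \<ge> 2"
  shows "(\<eta> + \<eta>^2 + \<eta>^3) * card (trav_ends (tile n) ws R) \<le> (2 + 2 * \<eta> + \<eta>^2 + (1 + \<eta> + \<eta>^2 + \<eta>^3)) * R * \<eta> ^ (n - 2)"
proof -
  define N where "N n = real (card (trav_ends (tile (n + 2)) ws R))" for n
  have NR: "N n \<le> R" "N n \<ge> 0" for n by (auto simp: N_def card_trav_ends_le)
  define V where "V n = N (n + 3) + (1 + \<eta>) * N (n + 2) + (1 + \<eta> + \<eta>^2) * N (n + 1) + (\<eta> + \<eta>^2 + \<eta>^3) * N n" for n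
  have rec: "N (n + 4) + N (n + 3) + N (n + 2) \<le> 2 * N n" for n
  proof -
    have "real (card (trav_ends (tile (n + 2 + 2)) ws R) + card (trav_ends (tile (n + 2 + 3)) ws R)
        + card (trav_ends (tile (n + 2 + 4)) ws R)) \<le> real (2 * card (trav_ends (tile (n + 2)) ws R))"
      using tile_recurrence[of "n + 2" ws R] by (intro of_nat_mono) simp
    then show ?thesis by (simp add: N_def eval_nat_numeral)
  qed
  have "V (Suc n) - \<eta> * V n = N (n + 4) + N (n + 3) + N (n + 2) - (\<eta> ^ 4 + \<eta> ^ 3 + \<eta> ^ 2) * N n" for n
    by (simp add: V_def algebra_simps eval_nat_numeral)
  moreover have "\<eta> ^ 4 + \<eta> ^ 3 + \<eta> ^ 2 = 2" using \<eta>(2) by simp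
  ultimately have "V (Suc n) - \<eta> * V n = N (n + 4) + N (n + 3) + N (n + 2) - 2 * N n" for n by metis
  then have Vs: "V (Suc n) \<le> \<eta> * V n" for n using rec[of n] by (smt (verit))
  have Vn: "V n \<le> \<eta> ^ n * V 0" for n
  proof (induction n)
    case (Suc n)
    have "V (Suc n) \<le> \<eta> * V n" by (rule Vs)
    also have "\<dots> \<le> \<eta> * (\<eta> ^ n * V 0)" using Suc \<eta>(1) by (intro mult_left_mono) auto
    finally show ?case by simp
  qed simp
  have "V 0 \<le> R + (1 + \<eta>) * R + (1 + \<eta> + \<eta>^2) * R + (\<eta> + \<eta>^2 + \<eta>^3) * R"
    unfolding V_def using \<eta>(1) NR by (intro add_mono mult_left_mono) auto
  also have "\<dots> = (2 + 2 * \<eta> + \<eta>^2 + (1 + \<eta> + \<eta>^2 + \<eta>^3)) * R" by (simp add: algebra_simps)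
  finally have V0: "V 0 \<le> \<dots>" .
  have "(\<eta> + \<eta>^2 + \<eta>^3) * N (n - 2) \<le> V (n - 2)" unfolding V_def using \<eta>(1) NR by simp
  also have "\<dots> \<le> \<eta> ^ (n - 2) * V 0" by (rule Vn)
  also have "\<dots> \<le> \<eta> ^ (n - 2) * ((2 + 2 * \<eta> + \<eta>^2 + (1 + \<eta> + \<eta>^2 + \<eta>^3)) * R)"
    using V0 \<eta>(1) by (intro mult_left_mono) auto
  finally show ?thesis using \<open>n \<ge> 2\<close> by (simp only: N_def le_add_diff_inverse2 mult_ac)
qed


section \<open>The tiles inside the orbits\<close>

fun state_of :: "gen \<Rightarrow> bcd" where
  "state_of Gc = State_c" | "state_of Gd = State_d" | "state_of _ = State_b"

fun act :: "gen \<Rightarrow> letter stream \<Rightarrow> letter stream" where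
  "act Ga0 = act_a0" | "act Ga1 = act_a1" | "act s = act_bcd (state_of s)"

lemma act_B: "s \<in> B_gens \<Longrightarrow> act s = act_bcd (state_of s)"
  by (cases s) (auto simp: B_gens_def)

definition prepend1 :: "letter stream \<Rightarrow> letter stream" where "prepend1 w = L1 ## w"

text \<open>The index is the only one for which the result can belong to \<open>X\<close>.\<close>

definition prepend0 :: "letter stream \<Rightarrow> letter stream" where
  "prepend0 w = L0 (case shd w of L0 x \<Rightarrow> \<not> x | L1 \<Rightarrow> True) ## w"

text \<open>The one of \<open>a\<^sub>0, a\<^sub>1\<close> that exchanges \<open>0w\<close> and \<open>1w\<close>; the other one fixes both.\<close>

definition a_label :: "letter stream \<Rightarrow> gen" where
  "a_label w = (if shd w = L0 True then Ga0 else Ga1)"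

lemma prepend1_X [simp]: "prepend1 w \<in> X \<longleftrightarrow> w \<in> X"
  by (simp add: prepend1_def L1_Cons_X)

lemma prepend0_X [simp]: "prepend0 w \<in> X \<longleftrightarrow> w \<in> X"
proof -
  obtain y v where w: "w = y ## v" by (metis stream.collapse)
  show ?thesis by (cases y) (auto simp: prepend0_def w X_Cons allowed_words_def)
qed

lemma X_cases:
  assumes "\<xi> \<in> X"
  obtains w where "w \<in> X" "\<xi> = prepend1 w" | w where "w \<in> X" "\<xi> = prepend0 w"
proof -
  obtain x y v where xi: "\<xi> = x ## y ## v" by (metis stream.collapse)
  show ?thesis
  proof (cases x)
    case L1
    then have "\<xi> = prepend1 (y ## v)" by (simp add: xi prepend1_def)
    then show ?thesis using that(1) assms by (metis prepend1_X)
  next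
    case (L0 z)
    then have "\<xi> = prepend0 (y ## v)" using assms by (cases y) (auto simp: xi prepend0_def X_Cons allowed_words_def)
    then show ?thesis using that(2) assms by (metis prepend0_X)
  qed
qed

lemma a_label_A: "a_label w \<in> A_gens"
  by (simp add: a_label_def A_gens_def)

lemma a_label_one [simp]: "a_label (prepend1 w) = Ga1"
  by (simp add: a_label_def prepend1_def)

lemma a_label_zero: "a_label (prepend0 w) = (if a_label w = Ga0 then Ga1 else Ga0)"
  by (auto simp: a_label_def prepend0_def split: letter.splits)

lemma a_label_zeros: "a_label ((prepend0 ^^ n) (prepend1 w)) = (if odd n then Ga0 else Ga1)"
  by (induction n) (auto simp: a_label_zero)

lemma act_A_zero: "s \<in> A_gens \<Longrightarrow> act s (prepend0 w) = (if s = a_label w then prepend1 w else prepend0 w)"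
proof -
  obtain y v where w: "w = y ## v" by (metis stream.collapse)
  show "s \<in> A_gens \<Longrightarrow> ?thesis"
    by (cases y; cases "y = L0 True") (auto simp: w A_gens_def a_label_def prepend0_def prepend1_def)
qed

lemma act_A_one: "s \<in> A_gens \<Longrightarrow> act s (prepend1 w) = (if s = a_label w then prepend0 w else prepend1 w)"
proof -
  obtain y v where w: "w = y ## v" by (metis stream.collapse)
  show "s \<in> A_gens \<Longrightarrow> ?thesis"
    by (cases y; cases "y = L0 True") (auto simp: w A_gens_def a_label_def prepend0_def prepend1_def)
qed

lemma act_a_one: "act_a (prepend1 w) = prepend0 w"
proof -
  obtain y v where w: "w = y ## v" by (metis stream.collapse)
  show ?thesis by (cases y) (auto simp: w prepend0_def prepend1_def)
qed

lemma act_a_zero: "act_a (prepend0 w) = prepend1 w"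
  by (simp add: prepend0_def prepend1_def)

lemma act_a_X: "w \<in> X \<Longrightarrow> act_a w \<in> X \<and> act_a (act_a w) = w"
  by (erule X_cases) (simp_all add: act_a_one act_a_zero)

lemma act_bcd_zero:
  "w \<in> X \<Longrightarrow> act_bcd q (prepend0 w) = (if q = State_d then prepend0 w else prepend0 (act_a w))"
proof (erule X_cases)
  fix v assume w: "w = prepend1 v"
  obtain y u where v: "v = y ## u" by (metis stream.collapse)
  show ?thesis unfolding w
    by (subst act_bcd_L0) (cases y; auto simp: prepend0_def prepend1_def v)+
next
  fix v assume w: "w = prepend0 v"
  show ?thesis unfolding w
    by (subst act_bcd_L0) (auto simp: prepend0_def)
qed

lemma act_bcd_one: "act_bcd q (prepend1 w) = prepend1 (act_bcd (next_bcd q) w)"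
  by (simp add: prepend1_def act_bcd_L1)

lemma act_bcd_ones: "act_bcd q ((prepend1 ^^ k) w) = (prepend1 ^^ k) (act_bcd ((next_bcd ^^ k) q) w)"
proof (induction k arbitrary: q)
  case (Suc k)
  then show ?case by (simp add: act_bcd_one funpow_swap1[of next_bcd])
qed simp

lemma next_missing: "s \<in> B_gens \<Longrightarrow> (next_bcd ^^ k) (state_of s) = State_d \<longleftrightarrow> s = missing k"
proof (induction k arbitrary: s)
  case 0
  then show ?case by (auto simp: B_gens_def)
next
  case (Suc k)
  define s' where "s' = (if s = Gb then Gc else if s = Gc then Gd else Gb)"
  have s': "s' \<in> B_gens" "next_bcd (state_of s) = state_of s'"
    using Suc.prems by (auto simp: s'_def B_gens_def)
  have "(next_bcd ^^ Suc k) (state_of s) = State_d \<longleftrightarrow> s' = missing k"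
    using Suc.IH[OF s'(1)] s'(2) by (simp only: funpow_Suc_right o_def)
  also have "\<dots> \<longleftrightarrow> s = missing (Suc k)"
    using Suc.prems missing_B[of k] by (auto simp: s'_def B_gens_def)
  finally show ?case .
qed

lemma act_B_ones_zero:
  assumes "s \<in> B_gens" "w \<in> X"
  shows "act s ((prepend1 ^^ k) (prepend0 w)) =
    (if s \<in> B_gens - {missing k} then (prepend1 ^^ k) (prepend0 (act_a w)) else (prepend1 ^^ k) (prepend0 w))"
  using assms next_missing[OF assms(1), of k]
  by (simp add: act_B act_bcd_ones act_bcd_zero)

lemma X_ones_cases:
  assumes "w \<in> X" "w !! k \<noteq> L1"
  obtains i u where "u \<in> X" "w = (prepend1 ^^ i) (prepend0 u)"
  using assms
proof (induction k arbitrary: w thesis)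
  case 0
  from 0(2) show ?case
  proof (cases rule: X_cases)
    case (2 u)
    then show ?thesis using 0(1)[of u 0] by simp
  qed (use 0(3) in \<open>simp add: prepend1_def\<close>)
next
  case (Suc k)
  from Suc(3) show ?case
  proof (cases rule: X_cases)
    case (1 v)
    then have "v !! k \<noteq> L1" using Suc(4) by (simp add: prepend1_def)
    then obtain i u where "u \<in> X" "v = (prepend1 ^^ i) (prepend0 u)" using Suc.IH 1 by blast
    then show ?thesis using Suc(2)[of u "Suc i"] 1 by simp
  next
    case (2 u)
    then show ?thesis using Suc(2)[of u 0] by simp
  qed
qed

lemma act_bcd_const: "\<forall>k. w !! k = L1 \<Longrightarrow> act_bcd q w = w"
proof (coinduction arbitrary: q w)
  case Eq_stream
  then have "shd w = L1" "\<forall>k. stl w !! k = L1" by (metis snth.simps)+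
  then show ?case by auto
qed

text \<open>The letters \<open>b, c, d\<close> generate a Klein group whose orbits have at most two points here, so exactly one
  of them acts trivially if \<open>w\<close> contains a zero. At \<open>111\<dots>\<close> all three act trivially; then the lemma
  holds with \<open>w' = w\<close> and any \<open>m\<close>, which avoids a separate treatment of this end of the Schreier graph.\<close>

lemma outer_joint:
  assumes "w \<in> X"
  obtains m w' where "m \<in> B_gens" "w' \<in> X"
    "\<And>s. s \<in> B_gens \<Longrightarrow> act s ((prepend1 ^^ n) w) = (if s \<in> B_gens - {m} then (prepend1 ^^ n) w' else (prepend1 ^^ n) w)"
    "\<And>s. s \<in> B_gens \<Longrightarrow> act s ((prepend1 ^^ n) w') = (if s \<in> B_gens - {m} then (prepend1 ^^ n) w else (prepend1 ^^ n) w')"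
proof (cases "\<exists>k. w !! k \<noteq> L1")
  case True
  then obtain i u where u: "u \<in> X" "w = (prepend1 ^^ i) (prepend0 u)" using X_ones_cases assms by metis
  have X': "(prepend1 ^^ k) v \<in> X \<longleftrightarrow> v \<in> X" for k v by (induction k) auto
  have e: "(prepend1 ^^ n) ((prepend1 ^^ i) v) = (prepend1 ^^ (n + i)) v" for v by (simp add: funpow_add)
  show ?thesis
    by (rule that[of "missing (n + i)" "(prepend1 ^^ i) (prepend0 (act_a u))"])
      (use u act_a_X[OF u(1)] in \<open>simp_all only: e X' missing_B act_B_ones_zero prepend0_X if_True\<close>)
next
  case False
  then have "act s ((prepend1 ^^ n) w) = (prepend1 ^^ n) w" if "s \<in> B_gens" for s
    using that by (simp add: act_B act_bcd_ones act_bcd_const)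
  then show ?thesis using that[of Gb w] assms by (auto simp: B_gens_def)
qed

text \<open>The points of the tile \<open>K\<^sub>n\<close> over the tail \<open>w\<close>.\<close>

fun points :: "nat \<Rightarrow> letter stream \<Rightarrow> letter stream list" where
  "points 0 w = [w]"
| "points (Suc 0) w = [prepend1 w]"
| "points (Suc (Suc n)) w =
     points (Suc n) (prepend1 w) @ rev (points n (prepend0 (prepend1 w))) @ points n (prepend0 (prepend0 w))"

lemma points_nonempty [simp]: "points n w \<noteq> []"
  by (induction n w rule: points.induct) auto

lemma length_points: "length (points n w) = Suc (length (tile n))"
proof (induction n arbitrary: w rule: tile.induct)
  case (3 n)
  show ?case using 3(1) 3(2) by simp
qed auto

lemma hd_points [simp]: "hd (points n w) = (prepend1 ^^ n) w"
proof (induction n w rule: points.induct)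
  case (3 n w)
  then show ?case by (simp add: hd_append funpow_swap1)
qed auto

lemma last_points: "last (points n w) = (if even n then (prepend0 ^^ n) w else prepend1 ((prepend0 ^^ (n - 1)) w))"
proof (induction n w rule: points.induct)
  case (3 n w)
  then show ?case by (cases n) (auto simp add: funpow_swap1)
qed auto

text \<open>The points \<open>xs\<close> of the orbit are moved like the vertices of \<open>P\<close>, except that nothing is claimed for
  the letters in \<open>U\<close> at the first and those in \<open>V\<close> at the last vertex: there the orbit continues.
  Repetitions in \<open>xs\<close> are allowed, which covers the reflection at \<open>111\<dots>\<close>.\<close>

definition chart :: "gen set \<Rightarrow> gen set list \<Rightarrow> gen set \<Rightarrow> letter stream list \<Rightarrow> bool" where
  "chart U P V xs \<longleftrightarrow> length xs = Suc (length P) \<and>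
     (\<forall>p\<le>length P. \<forall>s. (p = 0 \<longrightarrow> s \<notin> U) \<and> (p = length P \<longrightarrow> s \<notin> V) \<longrightarrow>
        act s (xs ! p) = xs ! step P s p)"

lemma chart_rev:
  assumes "chart U P V xs" "proper P"
  shows "chart V (rev P) U (rev xs)"
  unfolding chart_def
proof (intro conjI allI impI)
  show "length (rev xs) = Suc (length (rev P))" using assms by (simp add: chart_def)
  fix p s assume p: "p \<le> length (rev P)" and s: "(p = 0 \<longrightarrow> s \<notin> V) \<and> (p = length (rev P) \<longrightarrow> s \<notin> U)"
  let ?p = "length P - p"
  have "act s (xs ! ?p) = xs ! step P s ?p"
    using assms(1) p s unfolding chart_def by auto
  moreover have "step (rev P) s p = length P - step P s ?p"
    using step_rev[OF assms(2), of ?p s] p by simp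
  moreover have "step P s ?p \<le> length P" by (simp add: step_le_length)
  ultimately show "act s (rev xs ! p) = rev xs ! step (rev P) s p"
    using assms(1) p by (simp add: chart_def rev_nth)
qed

lemma chart_glue:
  assumes P: "chart U P V xs" and Q: "chart V Q W ys" and "e \<subseteq> V"
    and l: "\<And>s. s \<in> V \<Longrightarrow> act s (last xs) = (if s \<in> e then hd ys else last xs)"
    and r: "\<And>s. s \<in> V \<Longrightarrow> act s (hd ys) = (if s \<in> e then last xs else hd ys)"
    and lP: "P \<noteq> [] \<Longrightarrow> last P \<inter> V = {}" and hQ: "Q \<noteq> [] \<Longrightarrow> hd Q \<inter> V = {}"
  shows "chart U (P @ [e] @ Q) W (xs @ ys)"
  unfolding chart_def
proof (intro conjI allI impI)
  let ?R = "P @ [e] @ Q" and ?L = "length P"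
  have len: "length xs = Suc ?L" "length ys = Suc (length Q)" using P Q by (auto simp: chart_def)
  then have ne: "xs \<noteq> []" "ys \<noteq> []" by auto
  have lx: "last xs = xs ! ?L" using len ne by (simp add: last_conv_nth)
  have hy: "hd ys = ys ! 0" using ne by (simp add: hd_conv_nth)
  have lP': "P ! (?L - 1) \<inter> V = {}" if "0 < ?L" using lP that by (simp add: last_conv_nth)
  have hQ': "Q ! 0 \<inter> V = {}" if "0 < length Q" using hQ that by (simp add: hd_conv_nth)
  show "length (xs @ ys) = Suc (length ?R)" using len by simp
  fix p s assume p: "p \<le> length ?R" and s: "(p = 0 \<longrightarrow> s \<notin> U) \<and> (p = length ?R \<longrightarrow> s \<notin> W)"
  consider "p < ?L" | "p = ?L" | "p = Suc ?L" | r where "p = Suc (Suc (?L + r))" "r < length Q"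
  proof -
    have "\<exists>r. p = Suc (Suc (?L + r)) \<and> r < length Q" if "p > Suc ?L"
      using less_imp_Suc_add[OF that] p by auto
    then show ?thesis using that by (meson linorder_neqE_nat not_less_eq)
  qed
  then show "act s ((xs @ ys) ! p) = (xs @ ys) ! step ?R s p"
  proof cases
    case 1
    have "step ?R s p = step P s p" using 1 by (auto simp: step_def nth_append)
    moreover have "step P s p \<le> ?L" using 1 by (simp add: step_le_length)
    moreover have "act s (xs ! p) = xs ! step P s p" using P s 1 by (auto simp: chart_def)
    ultimately show ?thesis using 1 len by (simp add: nth_append)
  next
    case 2
    show ?thesis
    proof (cases "s \<in> V")
      case True
      have "step ?R s p = (if s \<in> e then Suc ?L else ?L)"
        using True 2 lP' by (auto simp: step_def nth_append)
      then show ?thesis using l[OF True] 2 len by (simp add: nth_append lx hy)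
    next
      case False
      then have "s \<notin> e" using \<open>e \<subseteq> V\<close> by blast
      then have "step ?R s p = step P s p" using 2 by (auto simp: step_def nth_append)
      moreover have "step P s p \<le> ?L" using 2 by (simp add: step_le_length)
      moreover have "act s (xs ! p) = xs ! step P s p" using P s 2 False by (auto simp: chart_def)
      ultimately show ?thesis using 2 len by (simp add: nth_append)
    qed
  next
    case 3
    show ?thesis
    proof (cases "s \<in> V")
      case True
      have "step ?R s p = (if s \<in> e then ?L else Suc ?L)"
        using True 3 hQ' by (auto simp: step_def nth_append)
      then show ?thesis using r[OF True] 3 len by (simp add: nth_append lx hy)
    next
      case False
      then have "s \<notin> e" using \<open>e \<subseteq> V\<close> by blast
      then have "step ?R s p = Suc ?L + step Q s 0" using 3 by (auto simp: step_def nth_append)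
      moreover have "act s (ys ! 0) = ys ! step Q s 0" using Q s 3 False by (auto simp: chart_def)
      ultimately show ?thesis using 3 len by (simp add: nth_append)
    qed
  next
    case 4
    have "step ?R s p = Suc ?L + step Q s (Suc r)" using 4 by (auto simp: step_def nth_append)
    moreover have "act s (ys ! Suc r) = ys ! step Q s (Suc r)" using Q s 4 by (auto simp: chart_def)
    ultimately show ?thesis using 4 len by (simp add: nth_append)
  qed
qed

text \<open>The edge whose label is not determined by the prefix joins the ends of two tiles of consecutive
  levels. Up to the order, they are \<open>0v\<close> and \<open>1v\<close> for \<open>v = 0\<^sup>nw\<close>.\<close>

lemma special_joint:
  fixes n w defines "x \<equiv> last (points (Suc n) w)" and "y \<equiv> last (points n (prepend0 w))"
    and "l \<equiv> a_label ((prepend0 ^^ n) w)"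
  assumes "s \<in> A_gens"
  shows "act s x = (if s \<in> {l} then y else x)" "act s y = (if s \<in> {l} then x else y)"
proof -
  let ?v = "(prepend0 ^^ n) w"
  have "x = (if even n then prepend1 ?v else prepend0 ?v)"
    by (simp add: x_def last_points funpow_swap1)
  moreover have "y = (if even n then prepend0 ?v else prepend1 ?v)"
    unfolding y_def last_points by (cases n) (auto simp: funpow_swap1)
  ultimately show "act s x = (if s \<in> {l} then y else x)" "act s y = (if s \<in> {l} then x else y)"
    using act_A_zero[OF assms(4), of ?v] act_A_one[OF assms(4), of ?v] by (auto simp: l_def)
qed

lemma tile_inter:
  "tile n \<noteq> [] \<Longrightarrow> hd (tile n) \<inter> B_gens = {}" "tile n \<noteq> [] \<Longrightarrow> last (tile n) \<inter> A_gens = {}"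
  using tile_ends[of n] by (auto simp: B_gens_compl)

lemma chart_joined:
  assumes "chart B_gens (tile n) A_gens (points n w)" "chart B_gens (tile n) A_gens (points n w')"
    and "\<And>s. s \<in> B_gens \<Longrightarrow> act s ((prepend1 ^^ n) w) = (if s \<in> B_gens - {m} then (prepend1 ^^ n) w' else (prepend1 ^^ n) w)"
    and "\<And>s. s \<in> B_gens \<Longrightarrow> act s ((prepend1 ^^ n) w') = (if s \<in> B_gens - {m} then (prepend1 ^^ n) w else (prepend1 ^^ n) w')"
  shows "chart A_gens (joined m (tile n)) A_gens (rev (points n w) @ points n w')"
  unfolding joined_def
  using assms tile_inter[of n]
  by (intro chart_glue[where V = B_gens] chart_rev) (auto simp: last_rev proper_tile)

lemma chart_tile:
  assumes "w \<in> X"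
  shows "chart B_gens (tile n) A_gens (points n w)"
  using assms
proof (induction n arbitrary: w rule: tile.induct)
  case 1
  then show ?case by (simp add: chart_def) (auto simp: B_gens_compl)
next
  case 2
  then show ?case by (simp add: chart_def) (auto simp: B_gens_compl)
next
  case (3 n)
  let ?w = "prepend1 w" and ?e = "{if odd n then Ga0 else Ga1}"
  have J: "chart A_gens (joined (missing n) (tile n)) A_gens
      (rev (points n (prepend0 ?w)) @ points n (prepend0 (prepend0 w)))"
    using 3 act_B_ones_zero[of _ ?w n] act_B_ones_zero[of _ "prepend0 w" n]
    by (intro chart_joined) (simp_all add: act_a_one act_a_zero)
  have hdJ: "hd (joined (missing n) (tile n)) \<inter> A_gens = {}"
    using tile_inter[of n] by (cases "tile n = []") (auto simp: joined_def B_gens_compl hd_append hd_rev)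
  show ?case
    unfolding tile.simps points.simps
    by (rule chart_glue[where V = A_gens])
      (use 3 J hdJ tile_inter[of "Suc n"] special_joint[of _ n ?w] in
        \<open>auto simp: a_label_zeros A_gens_def hd_rev split: if_splits\<close>)
qed

text \<open>The surroundings of the two edges with undetermined labels \<open>s, s'\<close> that are nearest to the inner
  joint of level \<open>k\<close>. Both ends are initial vertices of tiles of level \<open>k + 1\<close>. Together with the paths
  \<open>joined m (tile (k + 1))\<close>, which surround these initial vertices, they cover the orbits, each
  containing the ends of the others in its interior.\<close>

definition center :: "nat \<Rightarrow> gen \<Rightarrow> gen \<Rightarrow> gen set list" where
  "center k s s' = tile (Suc k) @ [{s}] @ joined (missing k) (tile k) @ [{s'}] @ rev (tile (Suc k))"

definition center_points :: "nat \<Rightarrow> letter stream \<Rightarrow> letter stream list" where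
  "center_points k w = points (Suc k) w @ (rev (points k (prepend0 w)) @ points k (prepend0 (act_a w))) @
     rev (points (Suc k) (act_a w))"

lemma chart_center:
  assumes "w \<in> X"
  shows "chart B_gens (center k (a_label ((prepend0 ^^ k) w)) (a_label ((prepend0 ^^ k) (act_a w)))) B_gens
    (center_points k w)"
proof -
  let ?v = "act_a w" and ?J = "joined (missing k) (tile k)"
  have v: "?v \<in> X" "act_a ?v = w" using act_a_X assms by auto
  have J: "chart A_gens ?J A_gens (rev (points k (prepend0 w)) @ points k (prepend0 ?v))"
    using assms v act_B_ones_zero[of _ w k] act_B_ones_zero[of _ ?v k]
    by (intro chart_joined chart_tile) simp_all
  have hdJ: "hd ?J \<inter> A_gens = {}" "last ?J \<inter> A_gens = {}"
    using tile_inter[of k] by (cases "tile k = []"; auto simp: joined_def B_gens_compl hd_append hd_rev)+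
  have R: "chart A_gens (?J @ [{a_label ((prepend0 ^^ k) ?v)}] @ rev (tile (Suc k))) B_gens
      ((rev (points k (prepend0 w)) @ points k (prepend0 ?v)) @ rev (points (Suc k) ?v))"
    by (rule chart_glue[where V = A_gens, OF J chart_rev[OF chart_tile[OF v(1)] proper_tile]])
      (use hdJ a_label_A tile_inter[of "Suc k"] special_joint[of _ k ?v] in \<open>auto simp: hd_rev\<close>)
  show ?thesis
    unfolding center_def center_points_def append_assoc[of "rev (points k (prepend0 w)) @ _", symmetric]
    by (rule chart_glue[where V = A_gens, OF chart_tile[OF assms]])
      (use R hdJ a_label_A tile_inter[of "Suc k"] special_joint[of _ k w] in
        \<open>auto simp: hd_rev joined_def hd_append\<close>)
qed

lemma proper_joined_tile: "proper (joined m (tile k))"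
  using tile_ends by (intro proper_joined proper_tile) auto

lemma joined_tile_ends: "hd (joined m (tile k)) \<subseteq> B_gens" "last (joined m (tile k)) \<subseteq> B_gens"
  using tile_ends[of k] by (cases "tile k = []"; auto simp: joined_def hd_append hd_rev)+

lemma proper_center:
  assumes "s \<in> A_gens" "s' \<in> A_gens"
  shows "proper (center k s s')"
proof -
  have *: "e \<subseteq> B_gens \<Longrightarrow> s \<notin> e \<and> s' \<notin> e" for e using assms by (auto simp: B_gens_compl)
  have "tile (Suc k) \<noteq> [] \<Longrightarrow> s \<notin> last (tile (Suc k)) \<and> s' \<notin> last (tile (Suc k))"
    using tile_ends * by blast
  then show ?thesis
    using *[OF joined_tile_ends(1)] *[OF joined_tile_ends(2)] joined_nonempty
    by (auto simp: center_def proper_append proper_Cons proper_tile proper_joined_tile hd_append hd_rev)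
qed

text \<open>The points \<open>vw\<close> with \<open>|v| = k + 1\<close> lie in the tile of level \<open>k + 1\<close> over \<open>w\<close> or, beyond the edge with
  the undetermined label, in the tile of level \<open>k\<close> over \<open>0w\<close>.\<close>

lemma cover:
  assumes "\<xi> \<in> X"
  shows "\<exists>w\<in>X. \<xi> \<in> set (points (Suc k) w) \<union> set (points k (prepend0 w))"
proof (induction k)
  case 0
  show ?case using assms by (rule X_cases) auto
next
  case (Suc k)
  then obtain w where w: "w \<in> X" "\<xi> \<in> set (points (Suc k) w) \<union> set (points k (prepend0 w))" by blast
  from w(1) show ?case
  proof (cases rule: X_cases)
    case (1 v)
    then show ?thesis using w by (intro bexI[of _ v]) auto
  next
    case (2 v)
    then show ?thesis using w by (intro bexI[of _ v]) auto
  qed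
qed

section \<open>Portraits\<close>

text \<open>Used both for points (\<open>f = act\<close>) and for positions in a path (\<open>f = step P\<close>).\<close>

definition evolve :: "(gen \<Rightarrow> 'a \<Rightarrow> 'a) \<Rightarrow> (nat \<Rightarrow> gen) \<Rightarrow> nat \<Rightarrow> nat \<Rightarrow> 'a \<Rightarrow> 'a" where
  "evolve f ws t u x = fold f (map ws [t..<u]) x"

lemma evolve_same [simp]: "evolve f ws t t x = x"
  by (simp add: evolve_def)

lemma evolve_Suc: "t \<le> u \<Longrightarrow> evolve f ws t (Suc u) x = f (ws u) (evolve f ws t u x)"
  by (simp add: evolve_def)

lemma evolve_trans:
  assumes "t \<le> u" "u \<le> v"
  shows "evolve f ws t v x = evolve f ws u v (evolve f ws t u x)"
  using assms(2) by (induction v rule: dec_induct) (use assms(1) in \<open>auto simp: evolve_Suc\<close>)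

lemma evolve_step_le:
  assumes "p \<le> length P" "t \<le> u"
  shows "evolve (step P) ws t u p \<le> length P"
  using assms(2) by (induction u rule: dec_induct) (use assms(1) in \<open>auto simp: evolve_Suc step_le_length\<close>)

lemma walk_evolve: "walk P ws (\<lambda>v. evolve (step P) ws t v p) t u"
  by (auto simp: walk_def evolve_Suc)

definition hit :: "gen set list \<Rightarrow> (nat \<Rightarrow> gen) \<Rightarrow> nat \<Rightarrow> nat \<Rightarrow> nat \<Rightarrow> nat \<Rightarrow> bool" where
  "hit P ws R t p u \<longleftrightarrow> t \<le> u \<and> u \<le> R \<and> evolve (step P) ws t u p \<in> {0, length P} \<and>
     (\<forall>v. t \<le> v \<and> v < u \<longrightarrow> evolve (step P) ws t v p \<notin> {0, length P})"

lemma hit_unique: "hit P ws R t p u \<Longrightarrow> hit P ws R t p u' \<Longrightarrow> u = u'"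
  unfolding hit_def by (metis linorder_neqE_nat)

lemma not_hit:
  assumes "\<nexists>u. hit P ws R t p u" "t \<le> v" "v \<le> R"
  shows "evolve (step P) ws t v p \<notin> {0, length P}"
  using assms(2,3)
proof (induction v rule: less_induct)
  case (less v)
  show ?case
  proof
    assume "evolve (step P) ws t v p \<in> {0, length P}"
    then have "hit P ws R t p v" using less by (auto simp: hit_def)
    then show False using assms(1) by blast
  qed
qed

lemma chart_evolve:
  assumes "chart U P V xs" "p \<le> length P" "t \<le> u"
    and "\<And>v. t \<le> v \<Longrightarrow> v < u \<Longrightarrow> evolve (step P) ws t v p \<notin> {0, length P}"
  shows "evolve act ws t u (xs ! p) = xs ! evolve (step P) ws t u p"
  using assms(3,4)
proof (induction u rule: dec_induct)
  case (step u)
  let ?q = "evolve (step P) ws t u p"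
  have "?q \<notin> {0, length P}" "?q \<le> length P"
    using step assms(2) evolve_step_le by auto
  then have "act (ws u) (xs ! ?q) = xs ! Submission.step P (ws u) ?q"
    using assms(1) by (auto simp: chart_def)
  then show ?case using step by (simp add: evolve_Suc)
qed simp

lemma hit_right:
  assumes "hit (A @ Q) ws R t p u" "evolve (step (A @ Q)) ws t u p = length (A @ Q)"
    and "p \<le> length A" "Q \<noteq> []"
  shows "u \<in> trav_ends Q ws R"
proof -
  let ?q = "\<lambda>v. evolve (step (A @ Q)) ws t v p"
  have "?q v < length A + length Q" if "t \<le> v" "v < u" for v
    using assms(1) that evolve_step_le[of p "A @ Q" t v ws] assms(3) by (auto simp: hit_def le_less)
  then have "\<exists>q' i. t \<le> i \<and> traversal Q ws q' i u"
    using assms walk_evolve[of "A @ Q" ws t p u]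
    by (intro last_exit[of A Q "[]" ws ?q t u]) (auto simp: hit_def)
  then show ?thesis using assms(1) by (auto simp: trav_ends_def hit_def)
qed

lemma evolve_rev:
  assumes "proper P" "p \<le> length P" "t \<le> u"
  shows "evolve (step (rev P)) ws t u (length P - p) = length P - evolve (step P) ws t u p"
  using assms(3)
proof (induction u rule: dec_induct)
  case (step u)
  then show ?case using step_rev[OF assms(1) evolve_step_le[OF assms(2), of t u ws]]
    by (simp add: evolve_Suc)
qed simp

lemma hit_left:
  assumes "hit (rev Q @ B) ws R t p u" "evolve (step (rev Q @ B)) ws t u p = 0"
    and "length Q \<le> p" "p \<le> length (rev Q @ B)" "Q \<noteq> []" "proper (rev Q @ B)"
  shows "u \<in> trav_ends Q ws R"
proof -
  let ?P = "rev Q @ B" and ?p = "length (rev Q @ B) - p"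
  have r: "rev ?P = rev B @ Q" by simp
  note e = evolve_rev[OF assms(6) assms(4), unfolded r, of t _ ws]
  have le: "t \<le> v \<Longrightarrow> evolve (step ?P) ws t v p \<le> length ?P" for v
    using evolve_step_le[OF assms(4)] .
  have "hit (rev B @ Q) ws R t ?p u"
    unfolding hit_def
  proof (intro conjI allI impI)
    show "t \<le> u" "u \<le> R" using assms(1) by (auto simp: hit_def)
    then show "evolve (step (rev B @ Q)) ws t u ?p \<in> {0, length (rev B @ Q)}"
      using e assms(2) by simp
    fix v assume v: "t \<le> v \<and> v < u"
    then have "evolve (step ?P) ws t v p \<notin> {0, length ?P}" using assms(1) by (auto simp: hit_def)
    then show "evolve (step (rev B @ Q)) ws t v ?p \<notin> {0, length (rev B @ Q)}"
      using e[of v] v le[of v] by auto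
  qed
  moreover have "evolve (step (rev B @ Q)) ws t u ?p = length (rev B @ Q)"
    using e[of u] assms(1,2) by (auto simp: hit_def)
  ultimately show ?thesis
    by (rule hit_right) (use assms in auto)
qed

text \<open>The finitely many label patterns near the places where a trajectory stays between two traversals.\<close>

definition arenas :: "nat \<Rightarrow> gen set list set" where
  "arenas k = (\<lambda>(s, s'). center k s s') ` (A_gens \<times> A_gens) \<union>
     (\<lambda>m. joined m (tile (Suc k))) ` B_gens"

definition placed :: "nat \<Rightarrow> gen set list \<Rightarrow> letter stream list \<Rightarrow> bool" where
  "placed k P xs \<longleftrightarrow> P \<in> arenas k \<and> (\<exists>U V. chart U P V xs) \<and>
     (\<exists>w\<in>X. xs = center_points k w \<or> (\<exists>w'\<in>X. xs = rev (points (Suc k) w) @ points (Suc k) w'))"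

lemma placed_center:
  assumes "w \<in> X"
  shows "\<exists>P. placed k P (center_points k w)"
proof -
  have "center k (a_label ((prepend0 ^^ k) w)) (a_label ((prepend0 ^^ k) (act_a w))) \<in> arenas k"
    using a_label_A unfolding arenas_def by blast
  then show ?thesis using chart_center[OF assms, of k] assms unfolding placed_def by blast
qed

lemma placed_joined:
  assumes "w \<in> X"
  shows "\<exists>P w'. placed k P (rev (points (Suc k) w) @ points (Suc k) w')"
proof -
  obtain m w' where m: "m \<in> B_gens" "w' \<in> X"
    "\<And>s. s \<in> B_gens \<Longrightarrow> act s ((prepend1 ^^ Suc k) w) = (if s \<in> B_gens - {m} then (prepend1 ^^ Suc k) w' else (prepend1 ^^ Suc k) w)"
    "\<And>s. s \<in> B_gens \<Longrightarrow> act s ((prepend1 ^^ Suc k) w') = (if s \<in> B_gens - {m} then (prepend1 ^^ Suc k) w else (prepend1 ^^ Suc k) w')"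
    using outer_joint[OF assms] by blast
  have "joined m (tile (Suc k)) \<in> arenas k" using m by (auto simp: arenas_def)
  then show ?thesis
    using chart_joined[OF chart_tile[OF assms] chart_tile[OF m(2)] m(3,4)] m(2) assms
    unfolding placed_def by blast
qed

lemma nth_append_last: "length xs = Suc n \<Longrightarrow> (xs @ ys) ! n = last xs"
  by (metis diff_Suc_1 last_conv_nth length_0_conv lessI nat.distinct(1) nth_append)

text \<open>When a trajectory leaves one arena, it is in the middle of another one. By symmetry all arenas can be
  oriented such that this is the vertex number \<open>length (tile (k + 1))\<close>, the last one of the first tile.\<close>

lemma placed_ends:
  assumes "placed k P xs" "e \<in> {0, length P}"
  shows "\<exists>P' xs'. placed k P' xs' \<and> xs ! e = xs' ! length (tile (Suc k))"
proof -
  let ?L = "length (tile (Suc k))"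
  have len: "length xs = Suc (length P)" using assms(1) by (auto simp: placed_def chart_def)
  then have ne: "xs \<noteq> []" by auto
  have e: "xs ! e \<in> {hd xs, last xs}"
    using assms(2) len ne by (auto simp: hd_conv_nth last_conv_nth)
  have lp: "length (points (Suc k) w) = Suc ?L" for w by (rule length_points)
  have *: "\<exists>P' xs'. placed k P' xs' \<and> (prepend1 ^^ Suc k) w = xs' ! ?L" if w: "w \<in> X" for w
  proof -
    obtain P' w' where "placed k P' (rev (points (Suc k) w) @ points (Suc k) w')"
      using placed_joined[OF w] by blast
    moreover have "(rev (points (Suc k) w) @ points (Suc k) w') ! ?L = (prepend1 ^^ Suc k) w"
      using nth_append_last[of "rev (points (Suc k) w)" ?L] lp by (simp add: last_rev del: funpow.simps)
    ultimately show ?thesis by metis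
  qed
  have **: "\<exists>P' xs'. placed k P' xs' \<and> last (points (Suc k) w) = xs' ! ?L" if w: "w \<in> X" for w
  proof -
    have "center_points k w ! ?L = last (points (Suc k) w)"
      unfolding center_points_def by (rule nth_append_last) (rule lp)
    then show ?thesis using placed_center[OF w, of k] by metis
  qed
  from assms(1) obtain w where w: "w \<in> X"
    "xs = center_points k w \<or> (\<exists>w'\<in>X. xs = rev (points (Suc k) w) @ points (Suc k) w')"
    by (auto simp: placed_def)
  from w(2) show ?thesis
  proof (elim disjE bexE)
    assume xs: "xs = center_points k w"
    have "hd xs = (prepend1 ^^ Suc k) w" "last xs = (prepend1 ^^ Suc k) (act_a w)"
      unfolding xs center_points_def by (simp_all add: hd_append last_rev del: funpow.simps)
    then have "xs ! e = (prepend1 ^^ Suc k) w \<or> xs ! e = (prepend1 ^^ Suc k) (act_a w)" using e by auto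
    then show ?thesis using *[OF w(1)] *[of "act_a w"] act_a_X[OF w(1)] by metis
  next
    fix w' assume w': "w' \<in> X" and xs: "xs = rev (points (Suc k) w) @ points (Suc k) w'"
    have "hd xs = last (points (Suc k) w)" "last xs = last (points (Suc k) w')"
      unfolding xs by (simp_all add: hd_append hd_rev)
    then have "xs ! e = last (points (Suc k) w) \<or> xs ! e = last (points (Suc k) w')" using e by auto
    then show ?thesis using **[OF w(1)] **[OF w'] by metis
  qed
qed

lemma placed_cover:
  assumes "\<xi> \<in> X"
  obtains P xs p where "placed k P xs" "p \<le> length P" "\<xi> = xs ! p"
proof -
  obtain w where w: "w \<in> X" "\<xi> \<in> set (points (Suc k) w) \<union> set (points k (prepend0 w))"
    using cover[OF assms] by blast
  then have "\<xi> \<in> set (center_points k w)" by (auto simp: center_points_def)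
  then obtain p where "p < length (center_points k w)" "\<xi> = center_points k w ! p"
    by (auto simp: in_set_conv_nth)
  moreover obtain P where "placed k P (center_points k w)" using placed_center[OF w(1)] by blast
  moreover from this have "length (center_points k w) = Suc (length P)"
    by (auto simp: placed_def chart_def)
  ultimately show ?thesis using that[of P "center_points k w" p] by simp
qed

text \<open>From the middle of an arena an end is reached only by traversing a complete tile of level \<open>k + 1\<close>,
  towards its far end in a joined pair and towards its initial vertex in a center.\<close>

lemma arenas_hit:
  assumes "P \<in> arenas k" "k \<ge> 1" "hit P ws R t (length (tile (Suc k))) u"
  shows "u \<in> trav_ends (tile (Suc k)) ws R \<union> trav_ends (rev (tile (Suc k))) ws R"
proof -
  let ?K = "tile (Suc k)" and ?L = "length (tile (Suc k))"
  have ne: "?K \<noteq> []" using assms(2) tile_nonempty[of "k - 1"] by simp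
  have e: "evolve (step P) ws t u ?L \<in> {0, length P}" using assms(3) by (simp add: hit_def)
  from assms(1) consider s s' where "s \<in> A_gens" "s' \<in> A_gens" "P = center k s s'"
    | m where "P = joined m ?K" by (auto simp: arenas_def)
  then show ?thesis
  proof cases
    case 1
    define B where "B = [{s}] @ joined (missing k) (tile k) @ [{s'}]"
    have P: "P = rev (rev ?K) @ (B @ rev ?K)" "P = (?K @ B) @ rev ?K"
      by (simp_all add: 1 center_def B_def)
    have "proper P" using 1 proper_center by simp
    then show ?thesis
      using e hit_left[of "rev ?K" "B @ rev ?K" ws R t ?L u] hit_right[of "?K @ B" "rev ?K" ws R t ?L u]
        assms(3) ne unfolding P(1)[symmetric] P(2)[symmetric] by (auto simp: P)
  next
    case 2
    define B where "B = [B_gens - {m}]"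
    have P: "P = rev ?K @ (B @ ?K)" "P = (rev ?K @ B) @ ?K" by (simp_all add: 2 joined_def B_def)
    have "proper P" using 2 proper_joined_tile by simp
    then show ?thesis
      using e hit_left[of ?K "B @ ?K" ws R t ?L u] hit_right[of "rev ?K @ B" ?K ws R t ?L u]
        assms(3) ne unfolding P(1)[symmetric] P(2)[symmetric] by (auto simp: P)
  qed
qed

definition rank :: "nat set \<Rightarrow> nat \<Rightarrow> nat" where "rank T u = card {v \<in> T. v < u}"

text \<open>The time of the hit itself is too much information; its rank in the set of all relevant times suffices
  for going on with the table. The first component \<open>0\<close> marks that the word ends before the hit.\<close>

definition outcome :: "nat set \<Rightarrow> gen set list \<Rightarrow> (nat \<Rightarrow> gen) \<Rightarrow> nat \<Rightarrow> nat \<Rightarrow> nat \<Rightarrow> nat \<times> nat" where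
  "outcome T P ws R t p =
     (if \<exists>u. hit P ws R t p u
      then let u = THE u. hit P ws R t p u in (Suc (rank T u), evolve (step P) ws t u p)
      else (0, evolve (step P) ws t R p))"

lemma outcome_hit:
  "hit P ws R t p u \<Longrightarrow> outcome T P ws R t p = (Suc (rank T u), evolve (step P) ws t u p)"
  unfolding outcome_def by (metis (mono_tags, lifting) hit_unique the_equality)

text \<open>If the tables of two words agree on a stay, the stays end at the same point, either at the end of both
  words or at times of the same rank, from which the assumption takes over.\<close>

lemma outcome_step:
  assumes "placed k P xs" "p \<le> length P" "t \<le> R" "t' \<le> R'"
    and eq: "outcome T P ws R t p = outcome T' P ws' R' t' p"
    and IH: "\<And>v v' P' xs'. hit P ws R t p v \<Longrightarrow> hit P ws' R' t' p v' \<Longrightarrow> rank T v = rank T' v' \<Longrightarrow>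
      placed k P' xs' \<Longrightarrow> evolve act ws v R (xs' ! length (tile (Suc k))) =
        evolve act ws' v' R' (xs' ! length (tile (Suc k)))"
  shows "evolve act ws t R (xs ! p) = evolve act ws' t' R' (xs ! p)"
proof -
  obtain U V where ch: "chart U P V xs" using assms(1) by (auto simp: placed_def)
  show ?thesis
  proof (cases "\<exists>u. hit P ws R t p u")
    case True
    then obtain v where v: "hit P ws R t p v" by blast
    have "\<exists>u. hit P ws' R' t' p u"
      using eq unfolding outcome_hit[OF v] by (auto simp: outcome_def split: if_splits)
    then obtain v' where v': "hit P ws' R' t' p v'" by blast
    let ?e = "evolve (step P) ws t v p"
    have r: "rank T v = rank T' v'" "evolve (step P) ws' t' v' p = ?e"
      using eq unfolding outcome_hit[OF v] outcome_hit[OF v'] by auto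
    have "evolve act ws t v (xs ! p) = xs ! ?e" "evolve act ws' t' v' (xs ! p) = xs ! ?e"
      using chart_evolve[OF ch assms(2), of t v ws] chart_evolve[OF ch assms(2), of t' v' ws'] v v' r
      by (auto simp: hit_def)
    moreover obtain P' xs' where "placed k P' xs'" "xs ! ?e = xs' ! length (tile (Suc k))"
      using placed_ends[OF assms(1), of ?e] v by (auto simp: hit_def)
    ultimately show ?thesis
      using IH[OF v v' r(1)] v v' evolve_trans[of t v R act ws] evolve_trans[of t' v' R' act ws']
      by (simp add: hit_def)
  next
    case False
    then have F': "\<nexists>u. hit P ws' R' t' p u"
      using eq by (auto simp: outcome_def Let_def split: if_splits)
    have "evolve act ws t R (xs ! p) = xs ! evolve (step P) ws t R p"
      using not_hit[OF False] by (intro chart_evolve[OF ch assms(2,3)]) auto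
    moreover have "evolve act ws' t' R' (xs ! p) = xs ! evolve (step P) ws' t' R' p"
      using not_hit[OF F'] by (intro chart_evolve[OF ch assms(2,4)]) auto
    ultimately show ?thesis using eq False F' by (simp add: outcome_def)
  qed
qed

text \<open>The times at which a stay can end: at the end of a traversal, or, for the stay in which a trajectory
  starts, at the first hit after time \<open>0\<close>.\<close>

definition event_times :: "nat \<Rightarrow> (nat \<Rightarrow> gen) \<Rightarrow> nat \<Rightarrow> nat set" where
  "event_times k ws R = trav_ends (tile (Suc k)) ws R \<union> trav_ends (rev (tile (Suc k))) ws R \<union>
     {u. \<exists>P\<in>arenas k. \<exists>p\<le>length P. hit P ws R 0 p u}"

text \<open>A stay starts at time \<open>0\<close> anywhere in an arena, or in its middle at the relevant time of rank \<open>i - 1\<close>.\<close>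

definition keys :: "nat \<Rightarrow> nat \<Rightarrow> (nat \<times> gen set list \<times> nat) set" where
  "keys k M = {0} \<times> (SIGMA P:arenas k. {..length P}) \<union>
     {1..M} \<times> arenas k \<times> {length (tile (Suc k))}"

text \<open>For \<open>i\<close> larger than the number of relevant times, the entry has no meaning. The minimum with \<open>R\<close> keeps
  it in a finite range all the same.\<close>

definition portrait :: "nat \<Rightarrow> nat \<Rightarrow> (nat \<Rightarrow> gen) \<Rightarrow> nat \<Rightarrow> nat \<times> gen set list \<times> nat \<Rightarrow> nat \<times> nat" where
  "portrait k M ws R = (\<lambda>(i, P, p) \<in> keys k M. let T = event_times k ws R in
     outcome T P ws R (if i = 0 then 0 else min R (inv_into T (\<lambda>u. Suc (rank T u)) i)) p)"

lemma finite_event_times: "finite (event_times k ws R)"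
  by (rule finite_subset[of _ "{..R}"]) (auto simp: event_times_def trav_ends_def hit_def)

lemma event_times_le: "u \<in> event_times k ws R \<Longrightarrow> u \<le> R"
  by (auto simp: event_times_def trav_ends_def hit_def)

lemma inj_on_rank:
  assumes "finite T"
  shows "inj_on (\<lambda>u. Suc (rank T u)) T"
proof -
  have "rank T u < rank T v" if "u \<in> T" "v \<in> T" "u < v" for u v
    unfolding rank_def using that assms by (intro psubset_card_mono) auto
  then show ?thesis by (intro inj_onI) (metis less_irrefl linorder_neqE_nat old.nat.inject)
qed

lemma rank_less: "finite T \<Longrightarrow> u \<in> T \<Longrightarrow> rank T u < card T"
  unfolding rank_def by (intro psubset_card_mono) auto

lemma rank_le: "finite T \<Longrightarrow> rank T u \<le> card T"
  unfolding rank_def by (intro card_mono) auto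

lemma length_tile_arena:
  assumes "P \<in> arenas k" "k \<ge> 1"
  shows "0 < length (tile (Suc k))" "length (tile (Suc k)) < length P"
proof -
  have "tile (Suc k) \<noteq> []" using assms(2) tile_nonempty[of "k - 1"] by simp
  then show "0 < length (tile (Suc k))" by simp
  show "length (tile (Suc k)) < length P" using assms(1) by (auto simp: arenas_def center_def)
qed

theorem portrait_determines:
  assumes "k \<ge> 1" and M: "card (event_times k ws R) \<le> M" "card (event_times k ws' R') \<le> M"
    and eq: "portrait k M ws R = portrait k M ws' R'" and "\<xi> \<in> X"
  shows "evolve act ws 0 R \<xi> = evolve act ws' 0 R' \<xi>"
proof -
  let ?L = "length (tile (Suc k))" and ?T = "event_times k ws R" and ?T' = "event_times k ws' R'"
  note fin = finite_event_times[of k ws R] finite_event_times[of k ws' R']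
  have later: "evolve act ws u R (xs ! ?L) = evolve act ws' u' R' (xs ! ?L)"
    if "u \<in> ?T" "u' \<in> ?T'" "rank ?T u = rank ?T' u'" "placed k P xs" for u u' P xs
    using that
  proof (induction "R - u" arbitrary: u u' P xs rule: less_induct)
    case less
    have P: "P \<in> arenas k" using less.prems(4) by (simp add: placed_def)
    note L = length_tile_arena[OF P \<open>k \<ge> 1\<close>]
    let ?i = "Suc (rank ?T u)"
    have key: "(?i, P, ?L) \<in> keys k M"
      using P rank_less[OF fin(1) less.prems(1)] M by (auto simp: keys_def)
    have "inv_into ?T (\<lambda>u. Suc (rank ?T u)) ?i = u" "inv_into ?T' (\<lambda>u. Suc (rank ?T' u)) ?i = u'"
      using inv_into_f_f[OF inj_on_rank[OF fin(1)] less.prems(1)]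
        inv_into_f_f[OF inj_on_rank[OF fin(2)] less.prems(2)] less.prems(3) by simp_all
    then have out: "outcome ?T P ws R u ?L = outcome ?T' P ws' R' u' ?L"
      using fun_cong[OF eq, of "(?i, P, ?L)"] key event_times_le[OF less.prems(1)] event_times_le[OF less.prems(2)]
      by (simp add: portrait_def min_absorb2)
    show ?case
    proof (rule outcome_step[OF less.prems(4) _ _ _ out])
      show "?L \<le> length P" "u \<le> R" "u' \<le> R'" using L event_times_le less.prems by auto
      fix v v' P' xs'
      assume v: "hit P ws R u ?L v" and v': "hit P ws' R' u' ?L v'" and r: "rank ?T v = rank ?T' v'"
        and p: "placed k P' xs'"
      have "v \<in> ?T" "v' \<in> ?T'"
        using arenas_hit[OF P \<open>k \<ge> 1\<close> v] arenas_hit[OF P \<open>k \<ge> 1\<close> v'] by (auto simp: event_times_def)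
      moreover have "u \<noteq> v" using v L by (auto simp: hit_def)
      then have "R - v < R - u" using v by (auto simp: hit_def)
      ultimately show "evolve act ws v R (xs' ! ?L) = evolve act ws' v' R' (xs' ! ?L)"
        using less.hyps r p by blast
    qed
  qed
  obtain P xs p where p: "placed k P xs" "p \<le> length P" "\<xi> = xs ! p"
    using placed_cover[OF \<open>\<xi> \<in> X\<close>] by blast
  have P: "P \<in> arenas k" using p by (simp add: placed_def)
  then have "(0, P, p) \<in> keys k M" using p by (simp add: keys_def)
  then have out: "outcome ?T P ws R 0 p = outcome ?T' P ws' R' 0 p"
    using fun_cong[OF eq, of "(0, P, p)"] by (simp add: portrait_def)
  show ?thesis unfolding p(3)
  proof (rule outcome_step[OF p(1,2) _ _ out])
    fix v v' P' xs'
    assume v: "hit P ws R 0 p v" and v': "hit P ws' R' 0 p v'" and r: "rank ?T v = rank ?T' v'"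
      and pl: "placed k P' xs'"
    have "v \<in> ?T" "v' \<in> ?T'" using v v' P p(2) by (auto simp: event_times_def)
    then show "evolve act ws v R (xs' ! ?L) = evolve act ws' v' R' (xs' ! ?L)"
      using later r pl by blast
  qed auto
qed

lemma length_arena:
  assumes "P \<in> arenas k"
  shows "length P < 6 * 2 ^ k"
  using assms length_tile[of k] length_tile[of "Suc k"] by (auto simp: arenas_def center_def)

lemma card_arenas: "finite (arenas k)" "card (arenas k) \<le> 7"
proof -
  have A: "finite A_gens" "card A_gens = 2" "finite B_gens" "card B_gens = 3"
    by (auto simp: A_gens_def B_gens_def)
  then show "finite (arenas k)" by (simp add: arenas_def)
  have "card (arenas k) \<le> card (A_gens \<times> A_gens) + card B_gens"
    unfolding arenas_def using A
    by (intro order_trans[OF card_Un_le] add_mono card_image_le) auto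
  then show "card (arenas k) \<le> 7" using A by simp
qed

lemma card_arena_positions:
  "finite (SIGMA P:arenas k. {..length P})" "card (SIGMA P:arenas k. {..length P}) \<le> 42 * 2 ^ k"
proof -
  show "finite (SIGMA P:arenas k. {..length P})" using card_arenas by auto
  have "card (SIGMA P:arenas k. {..length P}) = (\<Sum>P\<in>arenas k. Suc (length P))"
    using card_arenas by (subst card_SigmaI) auto
  also have "\<dots> \<le> card (arenas k) * (6 * 2 ^ k)"
    using length_arena by (intro sum_bounded_above[THEN order_trans]) (auto simp: Suc_le_eq)
  also have "\<dots> \<le> 7 * (6 * 2 ^ k)" using card_arenas by (intro mult_right_mono) auto
  finally show "card (SIGMA P:arenas k. {..length P}) \<le> 42 * 2 ^ k" by simp
qed

lemma card_keys: "finite (keys k M)" "card (keys k M) \<le> 42 * 2 ^ k + 7 * M"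
proof -
  show "finite (keys k M)" using card_arenas card_arena_positions by (auto simp: keys_def)
  have "card (keys k M) \<le> card ({0::nat} \<times> (SIGMA P:arenas k. {..length P})) +
      card ({1..M} \<times> arenas k \<times> {length (tile (Suc k))})"
    unfolding keys_def by (rule card_Un_le)
  also have "\<dots> = card (SIGMA P:arenas k. {..length P}) + M * card (arenas k)"
    by (simp add: card_cartesian_product)
  also have "\<dots> \<le> 42 * 2 ^ k + M * 7"
    using card_arena_positions card_arenas by (intro add_mono mult_left_mono) auto
  finally show "card (keys k M) \<le> 42 * 2 ^ k + 7 * M" by simp
qed

lemma card_event_times:
  "card (event_times k ws R) \<le> card (trav_ends (tile (Suc k)) ws R) +
     card (trav_ends (rev (tile (Suc k))) ws R) + 42 * 2 ^ k"
proof -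
  let ?H = "{u. \<exists>P\<in>arenas k. \<exists>p\<le>length P. hit P ws R 0 p u}"
  have "?H \<subseteq> (\<lambda>(P, p). THE u. hit P ws R 0 p u) ` (SIGMA P:arenas k. {..length P})"
  proof
    fix u assume "u \<in> ?H"
    then obtain P p where h: "P \<in> arenas k" "p \<le> length P" "hit P ws R 0 p u" by blast
    then have "u = (THE u. hit P ws R 0 p u)" using hit_unique by (metis (mono_tags, lifting) the_equality)
    then show "u \<in> (\<lambda>(P, p). THE u. hit P ws R 0 p u) ` (SIGMA P:arenas k. {..length P})"
      using h by (intro image_eqI[of _ _ "(P, p)"]) auto
  qed
  then have "card ?H \<le> card (SIGMA P:arenas k. {..length P})"
    using surj_card_le[OF card_arena_positions(1)] by blast
  then have "card ?H \<le> 42 * 2 ^ k" using card_arena_positions(2) by (rule order_trans)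
  then show ?thesis
    unfolding event_times_def
    by (intro order_trans[OF card_Un_le] add_mono card_Un_le) auto
qed

lemma portrait_in:
  assumes "k \<ge> 1" "card (event_times k ws R) \<le> M"
  shows "portrait k M ws R \<in> keys k M \<rightarrow>\<^sub>E {..Suc M} \<times> {..<6 * 2 ^ k}"
proof (rule PiE_I)
  fix x assume x: "x \<in> keys k M"
  obtain i P p where xp: "x = (i, P, p)" by (cases x)
  have P: "P \<in> arenas k" "p \<le> length P"
    using x length_tile_arena(2)[OF _ assms(1)] by (auto simp: xp keys_def less_imp_le)
  have "outcome (event_times k ws R) P ws R t p \<in> {..Suc M} \<times> {..<6 * 2 ^ k}" if "t \<le> R" for t
  proof (cases "\<exists>u. hit P ws R t p u")
    case True
    then obtain u where u: "hit P ws R t p u" by blast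
    have "evolve (step P) ws t u p \<le> length P" using u P(2) by (intro evolve_step_le) (auto simp: hit_def)
    then show ?thesis
      using outcome_hit[OF u] rank_le[OF finite_event_times, of k ws R u] assms(2) length_arena[OF P(1)]
      by (simp add: le_less_trans)
  next
    case False
    have "evolve (step P) ws t R p \<le> length P" using that P(2) by (intro evolve_step_le)
    then show ?thesis using False length_arena[OF P(1)] by (simp add: outcome_def)
  qed
  then show "portrait k M ws R x \<in> {..Suc M} \<times> {..<6 * 2 ^ k}"
    using x by (simp add: portrait_def xp Let_def)
qed (simp add: portrait_def)

section \<open>Words, growth and asymptotics\<close>

lemma act_involution: "\<xi> \<in> X \<Longrightarrow> act s \<xi> \<in> X \<and> act s (act s \<xi>) = \<xi>"
  using act_a0_X act_a1_X act_bcd_X act_bcd_involution by (cases s) auto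

lemma gens_act: "gens = range (\<lambda>s. restrict (act s) X)"
proof -
  have "(UNIV :: gen set) = {Ga0, Ga1, Gb, Gc, Gd}" using gen.exhaust by auto
  then have "range (\<lambda>s. restrict (act s) X) = (\<lambda>s. restrict (act s) X) ` {Ga0, Ga1, Gb, Gc, Gd}"
    by (rule arg_cong)
  then show ?thesis by (simp add: gens_def act_b_def act_c_def act_d_def)
qed

abbreviation "GX \<equiv> right_BijGroup X"

lemma mult_GX: "f \<in> carrier GX \<Longrightarrow> g \<in> carrier GX \<Longrightarrow> f \<otimes>\<^bsub>GX\<^esub> g = compose X g f"
  by (simp add: right_BijGroup_def BijGroup_def)

lemma one_GX: "\<one>\<^bsub>GX\<^esub> = (\<lambda>\<xi>\<in>X. \<xi>)"
  by (simp add: right_BijGroup_def BijGroup_def)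

lemma act_carrier: "restrict (act s) X \<in> carrier GX"
  using gens_subset by (auto simp: gens_act)

lemma foldr_act:
  "foldr (\<otimes>\<^bsub>GX\<^esub>) (map (\<lambda>s. restrict (act s) X) ss) \<one>\<^bsub>GX\<^esub> = restrict (fold act ss) X \<and>
     restrict (fold act ss) X \<in> carrier GX"
proof (induction ss)
  case Nil
  interpret group GX by (rule group_right_BijGroup)
  show ?case using one_closed by (simp add: one_GX restrict_def)
next
  case (Cons s ss)
  interpret group GX by (rule group_right_BijGroup)
  have "restrict (act s) X \<otimes>\<^bsub>GX\<^esub> restrict (fold act ss) X = restrict (fold act (s # ss)) X"
    using Cons act_carrier act_involution by (simp add: mult_GX compose_def restrict_def fun_eq_iff)
  moreover have "restrict (act s) X \<otimes>\<^bsub>GX\<^esub> restrict (fold act ss) X \<in> carrier GX"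
    using Cons act_carrier by blast
  ultimately show ?case using Cons.IH by (simp only: list.map foldr.simps o_apply)
qed

lemma G_hat_word:
  assumes "g \<in> carrier G_hat"
  shows "\<exists>ss. g = restrict (fold act ss) X"
proof -
  interpret group GX by (rule group_right_BijGroup)
  have mult: "restrict (fold act ss) X \<otimes>\<^bsub>GX\<^esub> restrict (fold act ts) X = restrict (fold act (ss @ ts)) X" for ss ts
  proof -
    have "fold act ss \<xi> \<in> X" if "\<xi> \<in> X" for \<xi>
      using that act_involution by (induction ss arbitrary: \<xi>) auto
    then show ?thesis
      using foldr_act by (simp add: mult_GX compose_def restrict_def fun_eq_iff)
  qed
  have "g \<in> generate GX gens"
    using assms gens_subset by (simp add: G_hat_def subgroup_generated_def Int_absorb1)
  then show ?thesis
  proof (induction rule: generate.induct)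
    case one
    then show ?case by (intro exI[of _ "[]"]) (simp add: one_GX restrict_def)
  next
    case (incl h)
    then obtain s where "h = restrict (act s) X" by (auto simp: gens_act)
    then show ?case by (intro exI[of _ "[s]"]) simp
  next
    case (inv h)
    then obtain s where h: "h = restrict (fold act [s]) X" by (auto simp: gens_act)
    have "h \<otimes>\<^bsub>GX\<^esub> h = \<one>\<^bsub>GX\<^esub>"
      unfolding h mult one_GX using act_involution by (simp add: restrict_def fun_eq_iff)
    then have "inv\<^bsub>GX\<^esub> h = h"
      using gens_subset inv.hyps by (intro inv_equality) auto
    then show ?case using h by blast
  next
    case (eng h1 h2)
    then show ?case using mult by metis
  qed
qed

lemma G_hat_short_word:
  assumes "g \<in> carrier G_hat"
  obtains ss where "length ss = word_length G_hat gens g" "g = restrict (fold act ss) X"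
proof -
  have G: "mult G_hat = mult GX" "one G_hat = one GX"
    by (simp_all add: G_hat_def subgroup_generated_def)
  let ?Q = "\<lambda>l. \<exists>ws. length ws = l \<and> set ws \<subseteq> gens \<and> foldr (mult G_hat) ws (one G_hat) = g"
  obtain ss where "g = restrict (fold act ss) X" using G_hat_word[OF assms] by blast
  then have "?Q (length ss)"
    using foldr_act by (intro exI[of _ "map (\<lambda>s. restrict (act s) X) ss"]) (auto simp: G gens_act)
  then have "?Q (word_length G_hat gens g)" unfolding word_length_def by (rule LeastI)
  then obtain ws where ws: "length ws = word_length G_hat gens g" "set ws \<subseteq> gens"
    "foldr (mult G_hat) ws (one G_hat) = g" by blast
  then have "\<forall>f\<in>set ws. \<exists>s. f = restrict (act s) X" unfolding gens_act by blast
  then obtain ss where ss: "ws = map (\<lambda>s. restrict (act s) X) ss"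
    unfolding ex_map_conv[symmetric] by blast
  have "g = restrict (fold act ss) X"
    using ws(3) conjunct1[OF foldr_act, of ss] unfolding ss G by (simp only:)
  moreover have "length ss = word_length G_hat gens g" using ws(1) by (simp add: ss)
  ultimately show ?thesis using that by blast
qed

text \<open>A table has \<open>O(2\<^sup>k + M)\<close> entries, each being the rank of a time and a position in an arena.\<close>

lemma growth_le:
  assumes "k \<ge> 1" and M: "\<And>ws l. real l \<le> R \<Longrightarrow> card (event_times k ws l) \<le> M"
  shows "growth G_hat gens R \<le> real (((M + 2) * (6 * 2 ^ k)) ^ (42 * 2 ^ k + 7 * M))"
proof -
  let ?S = "{g \<in> carrier G_hat. real (word_length G_hat gens g) \<le> R}"
  have "\<exists>ss. real (length ss) \<le> R \<and> g = restrict (fold act ss) X" if "g \<in> ?S" for g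
  proof -
    from that have "g \<in> carrier G_hat" "real (word_length G_hat gens g) \<le> R" by auto
    from this(1) obtain ss where "length ss = word_length G_hat gens g" "g = restrict (fold act ss) X"
      by (rule G_hat_short_word)
    then show ?thesis using \<open>real (word_length G_hat gens g) \<le> R\<close> by (intro exI[of _ ss]) simp
  qed
  then have "\<forall>g\<in>?S. \<exists>ss. real (length ss) \<le> R \<and> g = restrict (fold act ss) X" by blast
  from bchoice[OF this] obtain ss
    where ss: "\<And>g. g \<in> ?S \<Longrightarrow> real (length (ss g)) \<le> R \<and> g = restrict (fold act (ss g)) X"
    by blast
  define \<phi> where "\<phi> g = portrait k M (nth (ss g)) (length (ss g))" for g
  let ?V = "{..Suc M} \<times> {..<6 * 2 ^ k :: nat}"
  have "0 < (M + 2) * (6 * 2 ^ k :: nat)" by (intro mult_pos_pos) auto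
  then have base: "1 \<le> (M + 2) * (6 * 2 ^ k :: nat)" by linarith
  have "inj_on \<phi> ?S"
  proof (rule inj_onI)
    fix g h assume g: "g \<in> ?S" and h: "h \<in> ?S" and eq: "\<phi> g = \<phi> h"
    have ev: "evolve act (nth xs) 0 (length xs) \<xi> = fold act xs \<xi>" for xs \<xi>
      by (simp add: evolve_def map_nth)
    have "fold act (ss g) \<xi> = fold act (ss h) \<xi>" if "\<xi> \<in> X" for \<xi>
      using portrait_determines[OF assms(1) M M eq[unfolded \<phi>_def] that] ss[OF g] ss[OF h] by (simp add: ev)
    then have "restrict (fold act (ss g)) X = restrict (fold act (ss h)) X" by (auto simp: restrict_def)
    then show "g = h" using ss[OF g] ss[OF h] by simp
  qed
  moreover have "\<phi> ` ?S \<subseteq> keys k M \<rightarrow>\<^sub>E ?V"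
    using portrait_in[OF assms(1) M] ss unfolding \<phi>_def by blast
  moreover have "finite (keys k M \<rightarrow>\<^sub>E ?V)" using card_keys(1) by (intro finite_PiE) auto
  ultimately have "card ?S \<le> card (keys k M \<rightarrow>\<^sub>E ?V)" by (rule card_inj_on_le)
  also have "\<dots> = card ?V ^ card (keys k M)"
    using card_keys(1) by (simp add: card_PiE)
  also have "card ?V = (M + 2) * (6 * 2 ^ k)" by (simp add: card_cartesian_product)
  also have "((M + 2) * (6 * 2 ^ k)) ^ card (keys k M) \<le> ((M + 2) * (6 * 2 ^ k)) ^ (42 * 2 ^ k + 7 * M)"
    by (rule power_increasing[OF card_keys(2) base])
  finally show ?thesis unfolding growth_def by (rule of_nat_mono)
qed

text \<open>The place where the strict inequality \<open>\<alpha> > \<beta>\<close> is used.\<close>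

lemma powr_absorbs_log:
  fixes \<alpha> \<beta> c d :: real
  assumes "\<beta> < \<alpha>" "0 \<le> \<beta>" "0 \<le> c" "0 \<le> d"
  shows "\<exists>C\<ge>1. \<forall>R\<ge>1. R powr \<beta> * (c + d * ln R) \<le> (C * R) powr \<alpha>"
proof -
  define \<epsilon> where "\<epsilon> = \<alpha> - \<beta>"
  have \<epsilon>: "\<epsilon> > 0" "\<alpha> > 0" using assms by (auto simp: \<epsilon>_def)
  define D where "D = max 1 (c + d / \<epsilon>)"
  have D: "D \<ge> 1" by (simp add: D_def)
  define C where "C = D powr (1 / \<alpha>)"
  have "C \<ge> 1" unfolding C_def using D \<epsilon> by (intro ge_one_powr_ge_zero) auto
  moreover have "R powr \<beta> * (c + d * ln R) \<le> (C * R) powr \<alpha>" if R: "R \<ge> 1" for R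
  proof -
    have "ln R \<le> R powr \<epsilon> / \<epsilon>" using R \<epsilon> by (intro ln_powr_bound) auto
    then have "d * ln R \<le> d / \<epsilon> * R powr \<epsilon>"
      using assms(4) by (metis mult_left_mono times_divide_eq_left times_divide_eq_right)
    moreover have "c \<le> c * R powr \<epsilon>"
      using assms(3) R \<epsilon> ge_one_powr_ge_zero[of R \<epsilon>] by (simp add: mult_le_cancel_left1)
    ultimately have "c + d * ln R \<le> (c + d / \<epsilon>) * R powr \<epsilon>" by (simp add: algebra_simps)
    also have "\<dots> \<le> D * R powr \<epsilon>" by (intro mult_right_mono) (auto simp: D_def)
    finally have "R powr \<beta> * (c + d * ln R) \<le> R powr \<beta> * (D * R powr \<epsilon>)"
      by (intro mult_left_mono) auto
    also have "\<dots> = D * R powr \<alpha>" by (simp add: \<epsilon>_def flip: powr_add)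
    also have "\<dots> = (C * R) powr \<alpha>"
      using R D \<epsilon> \<open>C \<ge> 1\<close> by (simp add: powr_mult C_def powr_powr)
    finally show ?thesis .
  qed
  ultimately show ?thesis by blast
qed

lemma eta_less_1:
  fixes \<eta> :: real
  assumes "\<eta> > 0" "\<eta> ^ 4 + \<eta> ^ 3 + \<eta> ^ 2 - 2 = 0"
  shows "\<eta> < 1"
proof (rule ccontr)
  assume "\<not> \<eta> < 1"
  then have "\<eta> ^ 4 \<ge> 1" "\<eta> ^ 3 \<ge> 1" "\<eta> ^ 2 \<ge> 1" by (auto intro: one_le_power)
  then show False using assms(2) by linarith
qed

lemma event_times_bound:
  fixes \<eta> :: real
  assumes \<eta>: "\<eta> > 0" "\<eta> ^ 4 + \<eta> ^ 3 + \<eta> ^ 2 - 2 = 0"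
  shows "\<exists>c\<ge>0. \<forall>k\<ge>3. \<forall>ws l. card (event_times k ws l) \<le> c * l * \<eta> ^ (k - 3) + 42 * 2 ^ k"
proof -
  define a where "a = \<eta> + \<eta>^2 + \<eta>^3"
  define b where "b = 2 + 2 * \<eta> + \<eta>^2 + (1 + \<eta> + \<eta>^2 + \<eta>^3)"
  have ab: "a > 0" "b > 0" using \<eta>(1) by (auto simp: a_def b_def intro!: add_pos_pos)
  have dec: "card (trav_ends (tile n) ws l) \<le> b / a * l * \<eta> ^ (n - 2)" if "n \<ge> 2" for n ws l
  proof -
    have "a * card (trav_ends (tile n) ws l) \<le> b * l * \<eta> ^ (n - 2)"
      unfolding a_def b_def by (rule eta_decay[OF \<eta> that])
    then have "card (trav_ends (tile n) ws l) \<le> (b * l * \<eta> ^ (n - 2)) / a"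
      using ab(1) by (simp add: pos_le_divide_eq mult.commute)
    then show ?thesis by simp
  qed
  have "card (event_times k ws l) \<le> (2 * b / a) * l * \<eta> ^ (k - 3) + 42 * 2 ^ k" if "k \<ge> 3" for k ws l
  proof -
    define j where "j = k - 3"
    then have k: "k = j + 3" using that by simp
    have 1: "card (trav_ends (tile (Suc k)) ws l) \<le> b / a * l * \<eta> ^ j"
    proof -
      have "card (trav_ends (tile (Suc k)) ws l) \<le> b / a * l * \<eta> ^ (j + 2)"
        using dec[of "Suc k" ws l] by (simp add: k)
      also have "\<dots> \<le> b / a * l * \<eta> ^ j"
        using ab \<eta>(1) eta_less_1[OF \<eta>] by (intro mult_left_mono power_decreasing) auto
      finally show ?thesis .
    qed
    have "card (trav_ends (rev (tile (Suc k))) ws l) \<le> card (trav_ends (tile (j + 2)) ws l)"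
      using trav_ends_rev_tile[of "j + 2" ws l] by (simp add: k numeral_eq_Suc)
    then have 2: "card (trav_ends (rev (tile (Suc k))) ws l) \<le> b / a * l * \<eta> ^ j"
      using dec[of "j + 2" ws l] by simp
    have "real (card (event_times k ws l)) \<le> real (card (trav_ends (tile (Suc k)) ws l) +
        card (trav_ends (rev (tile (Suc k))) ws l) + 42 * 2 ^ k)"
      using card_event_times by (intro of_nat_mono)
    then show ?thesis using 1 2 by (simp add: k)
  qed
  then show ?thesis using ab by (intro exI[of _ "2 * b / a"]) auto
qed

theorem mainTheorem3:
  fixes \<eta> \<alpha> :: real
  assumes "\<eta> > 0" and "\<eta> ^ 4 + \<eta> ^ 3 + \<eta> ^ 2 - 2 = 0"
    and "\<alpha> > ln 2 / (ln 2 - ln \<eta>)"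
  shows "growth G_hat gens \<preceq> (\<lambda>R. exp (R powr \<alpha>))"
proof -
  note \<eta> = assms(1,2)
  define \<theta> where "\<theta> = ln 2 - ln \<eta>"
  define \<beta> where "\<beta> = ln 2 / \<theta>"
  have "ln \<eta> < 0" using eta_less_1[OF \<eta>] \<eta>(1) by simp
  moreover have "ln (2 :: real) > 0" by simp
  ultimately have \<theta>: "\<theta> > 0" unfolding \<theta>_def by linarith
  then have \<beta>: "0 < \<beta>" "\<beta> < \<alpha>" using assms(3) by (auto simp: \<beta>_def \<theta>_def)
  obtain c where c: "c \<ge> 0"
    "\<And>k ws l. k \<ge> 3 \<Longrightarrow> card (event_times k ws l) \<le> c * l * \<eta> ^ (k - 3) + 42 * 2 ^ k"
    using event_times_bound[OF \<eta>] by blast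
  define c1 where "c1 = c + 672"
  define c2 where "c2 = 672 + 7 * c1"
  define c3 where "c3 = (c1 + 2) * 96"
  have pos: "c1 \<ge> 1" "c2 \<ge> 0" "c3 \<ge> 1" using c by (auto simp: c1_def c2_def c3_def)
  have main: "growth G_hat gens R \<le> exp (R powr \<beta> * (c2 * ln c3 + 2 * c2 * \<beta> * ln R))" if R: "R \<ge> 1" for R
  proof -
    \<comment> \<open>For the real level \<open>x\<close>, both \<open>2\<^sup>x\<close> and \<open>R\<eta>\<^sup>x\<close> are equal to \<open>R\<^sup>\<beta>\<close>.\<close>
    define x where "x = ln R / \<theta>"
    define n where "n = nat \<lceil>x\<rceil>"
    define k where "k = n + 3"
    define Y where "Y = R powr \<beta>"
    have Y1: "Y \<ge> 1" unfolding Y_def using R \<beta> by (intro ge_one_powr_ge_zero) auto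
    have x: "x \<ge> 0" using R \<theta> by (simp add: x_def)
    then have n: "x \<le> n" "n \<le> x + 1" unfolding n_def by linarith+
    have Y2: "2 powr x = Y" using R by (simp add: Y_def x_def \<beta>_def powr_def)
    have "R * \<eta> powr x = exp (ln R + x * ln \<eta>)" using R \<eta>(1) by (simp add: exp_add powr_def)
    also have "ln R + x * ln \<eta> = \<beta> * ln R"
      using \<theta> by (simp add: x_def \<beta>_def field_simps) (simp add: \<theta>_def algebra_simps)
    finally have Y3: "R * \<eta> powr x = Y" using R by (simp add: Y_def powr_def)
    have "(2::real) ^ n = 2 powr n" by (simp add: powr_realpow)
    also have "\<dots> \<le> 2 powr (x + 1)" using n by simp
    finally have two: "2 ^ k \<le> 16 * Y" by (simp add: k_def power_add powr_add Y2)
    have "\<eta> ^ n = \<eta> powr n" using \<eta>(1) by (simp add: powr_realpow)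
    also have "\<dots> \<le> \<eta> powr x" using n \<eta>(1) eta_less_1[OF \<eta>] by (intro powr_mono') auto
    finally have en: "\<eta> ^ n \<le> \<eta> powr x" .
    define M where "M = nat \<lfloor>c1 * Y\<rfloor>"
    have M: "real M \<le> c1 * Y" unfolding M_def using pos Y1 by simp
    have "card (event_times k ws l) \<le> M" if l: "real l \<le> R" for ws l
    proof -
      have "card (event_times k ws l) \<le> c * l * \<eta> ^ n + 42 * 2 ^ k"
        using c(2)[of k ws l] by (simp add: k_def)
      also have "c * l * \<eta> ^ n \<le> c * R * \<eta> powr x"
        using c(1) l en \<eta>(1) R by (intro mult_mono mult_nonneg_nonneg) auto
      also have "\<dots> = c * Y" using Y3 by simp
      also have "42 * 2 ^ k \<le> 672 * Y" using two by simp
      finally have "real (card (event_times k ws l)) \<le> c1 * Y" by (simp add: c1_def algebra_simps)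
      then show ?thesis unfolding M_def by (simp add: le_nat_floor)
    qed
    then have "growth G_hat gens R \<le> real (((M + 2) * (6 * 2 ^ k)) ^ (42 * 2 ^ k + 7 * M))"
      by (intro growth_le) (auto simp: k_def)
    also have "\<dots> = real ((M + 2) * (6 * 2 ^ k)) powr real (42 * 2 ^ k + 7 * M)"
      by (subst powr_realpow) (auto intro!: add_pos_nonneg)
    also have "\<dots> \<le> (c3 * (Y * Y)) powr real (42 * 2 ^ k + 7 * M)"
    proof (intro powr_mono2)
      have "real ((M + 2) * (6 * 2 ^ k)) = (real M + 2) * (6 * 2 ^ k)" by (simp add: algebra_simps)
      also have "\<dots> \<le> ((c1 + 2) * Y) * (6 * (16 * Y))"
        using M two Y1 pos by (intro mult_mono) (auto simp: algebra_simps)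
      finally show "real ((M + 2) * (6 * 2 ^ k)) \<le> c3 * (Y * Y)" by (simp add: c3_def algebra_simps)
    qed auto
    also have "\<dots> \<le> (c3 * (Y * Y)) powr (c2 * Y)"
    proof (intro powr_mono)
      have "real (42 * 2 ^ k + 7 * M) = 42 * 2 ^ k + 7 * real M" by simp
      also have "\<dots> \<le> 42 * (16 * Y) + 7 * (c1 * Y)"
        using two M by (intro add_mono mult_left_mono) auto
      finally show "real (42 * 2 ^ k + 7 * M) \<le> c2 * Y" by (simp add: c2_def algebra_simps)
      have "1 \<le> Y * Y" using Y1 mult_mono[of 1 Y 1 Y] by simp
      then show "1 \<le> c3 * (Y * Y)" using pos mult_mono[of 1 c3 1 "Y * Y"] by simp
    qed
    also have "\<dots> = exp (c2 * Y * ln (c3 * (Y * Y)))" using pos Y1 by (simp add: powr_def)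
    also have "ln (c3 * (Y * Y)) = ln c3 + 2 * (\<beta> * ln R)"
      using pos Y1 R by (simp add: ln_mult) (simp add: Y_def ln_powr)
    also have "c2 * Y * (ln c3 + 2 * (\<beta> * ln R)) = R powr \<beta> * (c2 * ln c3 + 2 * c2 * \<beta> * ln R)"
      by (simp add: Y_def algebra_simps)
    finally show ?thesis .
  qed
  have nn: "0 \<le> c2 * ln c3" "0 \<le> 2 * c2 * \<beta>" using pos \<beta> by auto
  obtain C where "C \<ge> 1" "\<And>R. R \<ge> 1 \<Longrightarrow> R powr \<beta> * (c2 * ln c3 + 2 * c2 * \<beta> * ln R) \<le> (C * R) powr \<alpha>"
    using powr_absorbs_log[OF \<beta>(2) less_imp_le[OF \<beta>(1)] nn] by blast
  then show ?thesis unfolding growth_preceq_def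
    using main by (intro exI[of _ C]) (meson exp_le_cancel_iff order_trans)
qed

end
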